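(* Let $(X,J)$ be a Kähler surface with $p_g>0$ and let $\alpha\in\mathcal H$, $\alpha\neq0$. If $f:C\to X$ is a $J_\alpha$-holomorphic map with connected domain that represents a $(1,1)$ class $A\neq0$, then $f$ is in fact a $J$-holomorphic map whose image $f(C)$ lies in the support of the zero divisor $D_\alpha$ of $\alpha$.
   Context: $X$ is a compact Kähler surface with complex structure $J$ and Kähler metric $\langle\cdot,\cdot\rangle$; $p_g=\dim_{\mathbb C}H^{2,0}(X)$. $\mathcal H=\mathrm{Re}(H^{2,0}\oplus H^{0,2})$ is the $2p_g$-dimensional real vector space identified with the space of holomorphic $(2,0)$-forms; $D_\alpha$ is the zero divisor of the corresponding holomorphic section of the canonical bundle. For $\alpha\in\mathcal H$, the endomorphism $K_\alpha$ of $TX$ is defined by $\langle u,K_\alpha v\rangle=\alpha(u,v)$, and $J_\alpha=(\mathrm{Id}+JK_\alpha)^{-1}J(\mathrm{Id}+JK_\alpha)$ is an almost complex structure on $X$. The domain $C$ is a connected (possibly nodal) closed complex curve with complex structure $j$; $f$ is $J_\alpha$-holomorphic if $\frac12(df+J_\alpha\,df\,j)=0$ on each component (equivalently $\bar\partial_Jf=K_\alpha\,\partial_Jf\,j$ with $\bar\partial_Jf=\frac12(df+J\,df\,j)$, $\partial_Jf=\frac12(df-J\,df\,j)$). *)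

theory Defs
  imports "HOL-Analysis.Analysis" "HOL-Library.Function_Algebras"
begin

section \<open>Smooth and holomorphic maps between open subsets of coordinate spaces\<close>

primrec Ck_on :: "nat \<Rightarrow> ('a::euclidean_space \<Rightarrow> 'b::real_normed_vector) \<Rightarrow> 'a set \<Rightarrow> bool" where
  "Ck_on 0 f S \<longleftrightarrow> continuous_on S f"
| "Ck_on (Suc k) f S \<longleftrightarrow> (\<forall>x\<in>S. f differentiable at x) \<and>
     (\<forall>v. Ck_on k (\<lambda>x. frechet_derivative f (at x) v) S)"

definition smooth_on :: "'a set \<Rightarrow> ('a::euclidean_space \<Rightarrow> 'b::real_normed_vector) \<Rightarrow> bool" where
  "smooth_on S f \<longleftrightarrow> (\<forall>k. Ck_on k f S)"

text \<open>The coordinate spaces are \<open>complex\<close> and \<open>complex \<times> complex\<close>. They are real Euclidean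
  spaces for the library, so multiplication by the imaginary unit is passed explicitly
  as \<open>i\<close> (\<open>I1\<close> resp. \<open>I2\<close> below).\<close>

definition holo_on :: "('a \<Rightarrow> 'a) \<Rightarrow> ('b \<Rightarrow> 'b) \<Rightarrow> 'a set
    \<Rightarrow> ('a::real_normed_vector \<Rightarrow> 'b::real_normed_vector) \<Rightarrow> bool" where
  "holo_on i i' S f \<longleftrightarrow> (\<forall>x\<in>S. f differentiable at x \<and>
     (\<forall>v. frechet_derivative f (at x) (i v) = i' (frechet_derivative f (at x) v)))"

definition I1 :: "complex \<Rightarrow> complex" where
  "I1 v = \<i> * v"

definition I2 :: "complex \<times> complex \<Rightarrow> complex \<times> complex" where
  "I2 v = (\<i> * fst v, \<i> * snd v)"


section \<open>Complex manifolds\<close>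

text \<open>A chart is its domain together with the coordinate map, whose values outside the domain
  are irrelevant.\<close>

type_synonym ('p, 'e) chart = "'p set \<times> ('p \<Rightarrow> 'e)"

record ('p, 'e) manifold =
  space_of :: "'p topology"
  atlas :: "('p, 'e) chart set"

definition coords :: "('p, 'e) chart \<Rightarrow> 'e set" where
  "coords c = snd c ` fst c"

definition point_of :: "('p, 'e) chart \<Rightarrow> 'e \<Rightarrow> 'p" where
  "point_of c = inv_into (fst c) (snd c)"

definition transition :: "('p, 'e) chart \<Rightarrow> ('p, 'e) chart \<Rightarrow> 'e \<Rightarrow> 'e" where
  "transition c d = snd d \<circ> point_of c"

definition is_chart :: "'p topology \<Rightarrow> ('p, 'e::topological_space) chart \<Rightarrow> bool" where
  "is_chart T c \<longleftrightarrow> openin T (fst c) \<and> open (coords c) \<and>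
     homeomorphic_map (subtopology T (fst c)) (top_of_set (coords c)) (snd c)"

definition complex_manifold :: "('e \<Rightarrow> 'e) \<Rightarrow> ('p, 'e::euclidean_space) manifold \<Rightarrow> bool" where
  "complex_manifold i M \<longleftrightarrow>
     Hausdorff_space (space_of M) \<and> second_countable (space_of M) \<and>
     (\<forall>c\<in>atlas M. is_chart (space_of M) c) \<and>
     topspace (space_of M) = (\<Union>c\<in>atlas M. fst c) \<and>
     (\<forall>c\<in>atlas M. \<forall>d\<in>atlas M. holo_on i i (snd c ` (fst c \<inter> fst d)) (transition c d))"

definition local_expr ::
    "('p, 'a) chart \<Rightarrow> ('q, 'b) chart \<Rightarrow> ('p \<Rightarrow> 'q) \<Rightarrow> 'a \<Rightarrow> 'b" where
  "local_expr c d F = snd d \<circ> F \<circ> point_of c"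

definition smooth_map :: "('p, 'a::euclidean_space) manifold \<Rightarrow> ('q, 'b::euclidean_space) manifold
    \<Rightarrow> ('p \<Rightarrow> 'q) \<Rightarrow> bool" where
  "smooth_map M N F \<longleftrightarrow> continuous_map (space_of M) (space_of N) F \<and>
     (\<forall>c\<in>atlas M. \<forall>d\<in>atlas N. smooth_on (snd c ` (fst c \<inter> F -` fst d)) (local_expr c d F))"


section \<open>Covariant tensor fields and exterior derivatives\<close>

text \<open>A tensor field is the family of its local expressions in the charts, subject to the
  transformation law. The expression in chart \<open>c\<close> at the coordinate point \<open>x\<close> acts on tangent
  vectors written in the coordinates of \<open>c\<close>. To make equality of tensor fields
  equality of functions, local expressions vanish outside the coordinate range of their chart.
  Values may be real or complex.\<close>

type_synonym ('p, 'e, 'b) field1 = "('p, 'e) chart \<Rightarrow> 'e \<Rightarrow> 'e \<Rightarrow> 'b"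
type_synonym ('p, 'e, 'b) field2 = "('p, 'e) chart \<Rightarrow> 'e \<Rightarrow> 'e \<Rightarrow> 'e \<Rightarrow> 'b"

definition one_form ::
    "('p, 'e::euclidean_space) manifold \<Rightarrow> ('p, 'e, 'b::real_normed_vector) field1 \<Rightarrow> bool" where
  "one_form M \<beta> \<longleftrightarrow>
     (\<forall>c\<in>atlas M. \<forall>x\<in>coords c. linear (\<beta> c x)) \<and>
     (\<forall>c\<in>atlas M. \<forall>v. smooth_on (coords c) (\<lambda>x. \<beta> c x v)) \<and>
     (\<forall>c\<in>atlas M. \<forall>d\<in>atlas M. \<forall>p\<in>fst c \<inter> fst d.
        let D = frechet_derivative (transition c d) (at (snd c p))
        in \<forall>v. \<beta> c (snd c p) v = \<beta> d (snd d p) (D v)) \<and>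
     (\<forall>c x. c \<notin> atlas M \<or> x \<notin> coords c \<longrightarrow> \<beta> c x = (\<lambda>_. 0))"

definition tensor2 ::
    "('p, 'e::euclidean_space) manifold \<Rightarrow> ('p, 'e, 'b::real_normed_vector) field2 \<Rightarrow> bool" where
  "tensor2 M T \<longleftrightarrow>
     (\<forall>c\<in>atlas M. \<forall>x\<in>coords c. bilinear (T c x)) \<and>
     (\<forall>c\<in>atlas M. \<forall>u v. smooth_on (coords c) (\<lambda>x. T c x u v)) \<and>
     (\<forall>c\<in>atlas M. \<forall>d\<in>atlas M. \<forall>p\<in>fst c \<inter> fst d.
        let D = frechet_derivative (transition c d) (at (snd c p))
        in \<forall>u v. T c (snd c p) u v = T d (snd d p) (D u) (D v)) \<and>
     (\<forall>c x. c \<notin> atlas M \<or> x \<notin> coords c \<longrightarrow> T c x = (\<lambda>_ _. 0))"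

definition two_form ::
    "('p, 'e::euclidean_space) manifold \<Rightarrow> ('p, 'e, 'b::real_normed_vector) field2 \<Rightarrow> bool" where
  "two_form M \<omega> \<longleftrightarrow> tensor2 M \<omega> \<and> (\<forall>c x v. \<omega> c x v v = 0)"

definition d1 :: "('p, 'e::euclidean_space, 'b::real_normed_vector) field1 \<Rightarrow> ('p, 'e, 'b) field2" where
  "d1 \<beta> c x u v =
     frechet_derivative (\<lambda>y. \<beta> c y v) (at x) u - frechet_derivative (\<lambda>y. \<beta> c y u) (at x) v"

definition d2 :: "('p, 'e::euclidean_space, 'b::real_normed_vector) field2
    \<Rightarrow> ('p, 'e) chart \<Rightarrow> 'e \<Rightarrow> 'e \<Rightarrow> 'e \<Rightarrow> 'e \<Rightarrow> 'b" where
  "d2 \<omega> c x u v w =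
     frechet_derivative (\<lambda>y. \<omega> c y v w) (at x) u
   - frechet_derivative (\<lambda>y. \<omega> c y u w) (at x) v
   + frechet_derivative (\<lambda>y. \<omega> c y u v) (at x) w"

definition closed_two_forms ::
    "('p, 'e::euclidean_space) manifold \<Rightarrow> ('p, 'e, real) field2 set" where
  "closed_two_forms M = {\<omega>. two_form M \<omega> \<and>
     (\<forall>c\<in>atlas M. \<forall>x\<in>coords c. \<forall>u v w. d2 \<omega> c x u v w = 0)}"

definition exact_two_forms ::
    "('p, 'e::euclidean_space) manifold \<Rightarrow> ('p, 'e, real) field2 set" where
  "exact_two_forms M = {\<omega>. two_form M \<omega> \<and>
     (\<exists>\<beta>. one_form M \<beta> \<and> (\<forall>c\<in>atlas M. \<forall>x\<in>coords c. \<omega> c x = d1 \<beta> c x))}"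


section \<open>Integration of top-degree forms\<close>

text \<open>On a compact manifold, a top-degree form is given in each chart by its coefficient \<open>\<mu> c x\<close>
  with respect to the standard volume form of the coordinate space. Holomorphic
  charts are mutually positively oriented, so the sum below is the integral
  with respect to the complex orientation, and it does not depend on the partition of unity,
  which is indexed by finitely many of the charts.\<close>

definition partition_of_unity ::
    "('p, 'e) manifold \<Rightarrow> ('p, 'e) chart set \<Rightarrow> (('p, 'e) chart \<Rightarrow> 'p \<Rightarrow> real) \<Rightarrow> bool" where
  "partition_of_unity M Q \<rho> \<longleftrightarrow> finite Q \<and> Q \<subseteq> atlas M \<and>
     (\<forall>c\<in>Q. continuous_map (space_of M) euclideanreal (\<rho> c) \<and>
        (\<forall>p\<in>topspace (space_of M). 0 \<le> \<rho> c p) \<and>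
        space_of M closure_of {p \<in> topspace (space_of M). \<rho> c p \<noteq> 0} \<subseteq> fst c) \<and>
     (\<forall>p\<in>topspace (space_of M). (\<Sum>c\<in>Q. \<rho> c p) = 1)"

definition manifold_integral ::
    "('p, 'e::euclidean_space) manifold \<Rightarrow> (('p, 'e) chart \<Rightarrow> 'e \<Rightarrow> real) \<Rightarrow> real" where
  "manifold_integral M \<mu> = (let (Q, \<rho>) = (SOME (Q, \<rho>). partition_of_unity M Q \<rho>)
     in \<Sum>c\<in>Q. (LINT x:coords c|lborel. \<rho> c (point_of c x) * \<mu> c x))"

text \<open>The coefficient of a wedge product of two 2-forms on a complex surface is its value on the
  positively oriented real frame \<open>e 1, I2 (e 1), e 2, I2 (e 2)\<close>.\<close>

definition wedge22 :: "('e \<Rightarrow> 'e \<Rightarrow> real) \<Rightarrow> ('e \<Rightarrow> 'e \<Rightarrow> real) \<Rightarrow> 'e \<Rightarrow> 'e \<Rightarrow> 'e \<Rightarrow> 'e \<Rightarrow> real" where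
  "wedge22 a b t u v w =
     a t u * b v w - a t v * b u w + a t w * b u v
   + a u v * b t w - a u w * b t v + a v w * b t u"

definition surface_wedge_integral :: "('p, complex \<times> complex) manifold
    \<Rightarrow> ('p, complex \<times> complex, real) field2 \<Rightarrow> ('p, complex \<times> complex, real) field2 \<Rightarrow> real" where
  "surface_wedge_integral X \<eta> \<omega> = manifold_integral X
     (\<lambda>c x. wedge22 (\<eta> c x) (\<omega> c x) (1, 0) (\<i>, 0) (0, 1) (0, \<i>))"

text \<open>In \<open>pullback_coeff\<close> the chart of \<open>X\<close> around the image point is arbitrary, by the
  transformation law.\<close>

definition pullback_coeff :: "('p, 'e::euclidean_space) manifold \<Rightarrow> ('s \<Rightarrow> 'p)
    \<Rightarrow> ('p, 'e, real) field2 \<Rightarrow> ('s, complex) chart \<Rightarrow> complex \<Rightarrow> real" where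
  "pullback_coeff X F \<omega> c x =
     (let d = (SOME d. d \<in> atlas X \<and> F (point_of c x) \<in> fst d);
          D = frechet_derivative (local_expr c d F) (at x)
      in \<omega> d (local_expr c d F x) (D 1) (D \<i>))"

definition curve_integral :: "('s, complex) manifold \<Rightarrow> ('p, 'e::euclidean_space) manifold
    \<Rightarrow> ('s \<Rightarrow> 'p) \<Rightarrow> ('p, 'e, real) field2 \<Rightarrow> real" where
  "curve_integral S X F \<omega> = manifold_integral S (pullback_coeff X F \<omega>)"


section \<open>Compact Kaehler surfaces and holomorphic 2-forms\<close>

definition kaehler_metric ::
    "('p, complex \<times> complex) manifold \<Rightarrow> ('p, complex \<times> complex, real) field2 \<Rightarrow> bool" where
  "kaehler_metric X g \<longleftrightarrow> tensor2 X g \<and>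
     (\<forall>c\<in>atlas X. \<forall>x\<in>coords c.
        (\<forall>u v. g c x u v = g c x v u) \<and>
        (\<forall>u. u \<noteq> 0 \<longrightarrow> g c x u u > 0) \<and>
        (\<forall>u v. g c x (I2 u) (I2 v) = g c x u v)) \<and>
     (\<lambda>c x u v. g c x (I2 u) v) \<in> closed_two_forms X"

definition compact_kaehler_surface ::
    "('p, complex \<times> complex) manifold \<Rightarrow> ('p, complex \<times> complex, real) field2 \<Rightarrow> bool" where
  "compact_kaehler_surface X g \<longleftrightarrow> complex_manifold I2 X \<and>
     compact_space (space_of X) \<and> connected_space (space_of X) \<and> kaehler_metric X g"

text \<open>The space \<open>H\<^sup>2\<^sup>,\<^sup>0(X)\<close> of holomorphic 2-forms, locally \<open>h dz\<^sub>1 \<and> dz\<^sub>2\<close> with \<open>h\<close>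
  holomorphic.\<close>

definition H20 ::
    "('p, complex \<times> complex) manifold \<Rightarrow> ('p, complex \<times> complex, complex) field2 set" where
  "H20 X = {\<phi>. two_form X \<phi> \<and> (\<forall>c\<in>atlas X. \<exists>h. holo_on I2 I1 (coords c) h \<and>
     (\<forall>x\<in>coords c. \<forall>u v. \<phi> c x u v = h x * (fst u * snd v - snd u * fst v)))}"

definition scale_field2 :: "complex \<Rightarrow> ('p, 'e, complex) field2 \<Rightarrow> ('p, 'e, complex) field2" where
  "scale_field2 a \<phi> = (\<lambda>c x u v. a * \<phi> c x u v)"

lemma vector_space_scale_field2: "vector_space scale_field2"
  by unfold_locales (auto simp: scale_field2_def fun_eq_iff algebra_simps)

definition geometric_genus :: "('p, complex \<times> complex) manifold \<Rightarrow> nat" where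
  "geometric_genus X = vector_space.dim scale_field2 (H20 X)"

text \<open>\<open>Re(H\<^sup>2\<^sup>,\<^sup>0 \<oplus> H\<^sup>0\<^sup>,\<^sup>2)\<close>: the real forms \<open>\<phi> + cnj \<phi>\<close>.\<close>

definition real_part_form ::
    "('p, 'e, complex) field2 \<Rightarrow> ('p, 'e, real) field2 \<Rightarrow> bool" where
  "real_part_form \<phi> \<alpha> \<longleftrightarrow> (\<forall>c x u v. complex_of_real (\<alpha> c x u v) = \<phi> c x u v + cnj (\<phi> c x u v))"

definition calH ::
    "('p, complex \<times> complex) manifold \<Rightarrow> ('p, complex \<times> complex, real) field2 set" where
  "calH X = {\<alpha>. \<exists>\<phi>\<in>H20 X. real_part_form \<phi> \<alpha>}"

definition holomorphic_form_of :: "('p, complex \<times> complex) manifold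
    \<Rightarrow> ('p, complex \<times> complex, real) field2 \<Rightarrow> ('p, complex \<times> complex, complex) field2" where
  "holomorphic_form_of X \<alpha> = (THE \<phi>. \<phi> \<in> H20 X \<and> real_part_form \<phi> \<alpha>)"

text \<open>The zero divisor is given by its local equations: in the chart \<open>c\<close>, the coefficient \<open>h\<close> of
  the holomorphic form \<open>h dz\<^sub>1 \<and> dz\<^sub>2\<close>, i.e. its value on the coordinate frame. The support is
  the set where the local equations vanish.\<close>

definition zero_divisor :: "('p, complex \<times> complex) manifold
    \<Rightarrow> ('p, complex \<times> complex, real) field2 \<Rightarrow> ('p, complex \<times> complex) chart
    \<Rightarrow> complex \<times> complex \<Rightarrow> complex" where
  "zero_divisor X \<alpha> c x = holomorphic_form_of X \<alpha> c x (1, 0) (0, 1)"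

definition divisor_support :: "('p, 'e) manifold
    \<Rightarrow> (('p, 'e) chart \<Rightarrow> 'e \<Rightarrow> complex) \<Rightarrow> 'p set" where
  "divisor_support X D = {p \<in> topspace (space_of X).
     \<forall>c\<in>atlas X. p \<in> fst c \<longrightarrow> D c (snd c p) = 0}"


section \<open>Almost complex structures and pseudoholomorphic maps\<close>

definition K_endo :: "('p, 'e, real) field2 \<Rightarrow> ('p, 'e, real) field2
    \<Rightarrow> ('p, 'e) chart \<Rightarrow> 'e \<Rightarrow> 'e \<Rightarrow> 'e" where
  "K_endo g \<alpha> c x v = (THE w. \<forall>u. g c x u w = \<alpha> c x u v)"

definition J_alpha :: "('p, complex \<times> complex, real) field2 \<Rightarrow> ('p, complex \<times> complex, real) field2
    \<Rightarrow> ('p, complex \<times> complex, complex \<times> complex) field1" where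
  "J_alpha g \<alpha> c x =
     (let B = (\<lambda>v. v + I2 (K_endo g \<alpha> c x v)) in inv B \<circ> I2 \<circ> B)"

definition J_std :: "('p, complex \<times> complex, complex \<times> complex) field1" where
  "J_std c x = I2"

definition pseudoholomorphic :: "('s, complex) manifold \<Rightarrow> ('p, 'e::euclidean_space) manifold
    \<Rightarrow> ('p, 'e, 'e) field1 \<Rightarrow> ('s \<Rightarrow> 'p) \<Rightarrow> bool" where
  "pseudoholomorphic S X J F \<longleftrightarrow> smooth_map S X F \<and>
     (\<forall>c\<in>atlas S. \<forall>d\<in>atlas X. \<forall>s\<in>fst c. F s \<in> fst d \<longrightarrow>
        (let D = frechet_derivative (local_expr c d F) (at (snd c s))
         in \<forall>v. (1/2) *\<^sub>R (D v + J d (snd d (F s)) (D (I1 v))) = 0))"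

text \<open>A closed, possibly nodal, complex curve \<open>C\<close> is presented by its normalization \<open>\<nu> : S \<rightarrow> C\<close>:
  \<open>S\<close> is a compact, possibly disconnected, Riemann surface and \<open>C\<close> is the topological quotient that glues
  finitely many disjoint pairs of points (the preimages of the nodes). The components of \<open>C\<close> are
  the images of those of \<open>S\<close>, so a condition on each component of \<open>C\<close> for a map
  \<open>f\<close> on \<open>C\<close> is a condition on \<open>f \<circ> \<nu>\<close>.\<close>

definition connected_nodal_curve :: "('s, complex) manifold \<Rightarrow> 'c topology \<Rightarrow> ('s \<Rightarrow> 'c) \<Rightarrow> bool" where
  "connected_nodal_curve S C \<nu> \<longleftrightarrow>
     complex_manifold I1 S \<and> compact_space (space_of S) \<and>
     quotient_map (space_of S) C \<nu> \<and>
     (\<forall>p\<in>topspace C. card {s \<in> topspace (space_of S). \<nu> s = p} \<in> {1, 2}) \<and>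
     finite {p \<in> topspace C. card {s \<in> topspace (space_of S). \<nu> s = p} = 2} \<and>
     connected_space C"


section \<open>Homology classes and their type\<close>

text \<open>Second real homology, as the dual of second de Rham cohomology: linear functionals on
  closed 2-forms that vanish on exact ones (and, for uniqueness, are set to zero on fields
  that are not closed 2-forms).\<close>

definition H2 :: "('p, 'e::euclidean_space) manifold \<Rightarrow> (('p, 'e, real) field2 \<Rightarrow> real) set" where
  "H2 X = {A.
     (\<forall>\<omega>\<in>closed_two_forms X. \<forall>\<theta>\<in>closed_two_forms X. \<forall>a b.
        A (\<lambda>c x u v. a * \<omega> c x u v + b * \<theta> c x u v) = a * A \<omega> + b * A \<theta>) \<and>
     (\<forall>\<omega>\<in>exact_two_forms X. A \<omega> = 0) \<and>
     (\<forall>\<omega>. \<omega> \<notin> closed_two_forms X \<longrightarrow> A \<omega> = 0)}"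

definition represents :: "('s, complex) manifold \<Rightarrow> ('p, 'e::euclidean_space) manifold
    \<Rightarrow> ('s \<Rightarrow> 'p) \<Rightarrow> (('p, 'e, real) field2 \<Rightarrow> real) \<Rightarrow> bool" where
  "represents S X F A \<longleftrightarrow> (\<forall>\<omega>\<in>closed_two_forms X. curve_integral S X F \<omega> = A \<omega>)"

text \<open>A real 2-form is of type (1,1) if it is locally \<open>\<Sum> a\<^sub>j\<^sub>k dz\<^sub>j \<and> cnj dz\<^sub>k\<close>.\<close>

definition zcoord :: "nat \<Rightarrow> complex \<times> complex \<Rightarrow> complex" where
  "zcoord j u = (if j = 1 then fst u else snd u)"

definition type11_form ::
    "('p, complex \<times> complex) manifold \<Rightarrow> ('p, complex \<times> complex, real) field2 \<Rightarrow> bool" where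
  "type11_form X \<eta> \<longleftrightarrow> two_form X \<eta> \<and>
     (\<forall>c\<in>atlas X. \<forall>x\<in>coords c. \<exists>a :: nat \<Rightarrow> nat \<Rightarrow> complex. \<forall>u v.
        complex_of_real (\<eta> c x u v) = (\<Sum>j\<in>{1,2}. \<Sum>k\<in>{1,2}.
          a j k * (zcoord j u * cnj (zcoord k v) - zcoord j v * cnj (zcoord k u))))"

text \<open>A homology class is of type (1,1) if its Poincare dual has a closed (1,1)
  representative, i.e. lies in \<open>H\<^sup>1\<^sup>,\<^sup>1(X)\<close>.\<close>

definition type11_class :: "('p, complex \<times> complex) manifold
    \<Rightarrow> (('p, complex \<times> complex, real) field2 \<Rightarrow> real) \<Rightarrow> bool" where
  "type11_class X A \<longleftrightarrow> (\<exists>\<eta>\<in>closed_two_forms X. type11_form X \<eta> \<and>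
     (\<forall>\<omega>\<in>closed_two_forms X. A \<omega> = surface_wedge_integral X \<eta> \<omega>))"

end

theory Submission
  imports Defs
begin

text \<open>For a \<open>J\<^sub>\<alpha>\<close>-holomorphic map \<open>f\<close>, the equation \<open>dbar f = K\<^sub>\<alpha> \<circ> \<partial>f \<circ> j\<close> turns the pullback
  \<open>f\<^sup>*\<alpha>\<close> into twice the pointwise energy of \<open>dbar f\<close>. Its integral is the pairing of \<open>A\<close> with
  \<open>\<alpha>\<close>, which vanishes because a (1,1)-form wedged with \<open>\<alpha>\<close> is zero. Hence \<open>dbar f = 0\<close>, and then
  also \<open>K\<^sub>\<alpha> \<circ> \<partial>f = 0\<close>. Away from the zeros of \<open>\<alpha>\<close> the endomorphism \<open>K\<^sub>\<alpha>\<close> is injective, so there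
  \<open>df = 0\<close> and \<open>f\<close> is locally constant. If \<open>f\<close> took a value \<open>x\<close> outside the zero divisor, its
  fibre over \<open>x\<close> would be open and closed in the connected curve, so \<open>f\<close> would be constant and
  \<open>A = 0\<close>.\<close>

section \<open>Partitions of unity\<close>

text \<open>\<open>manifold_integral\<close> picks its partition by choice, so existence has to be
  known before any integral can be evaluated. Complete regularity gives a bump function at each
  point, compactness selects finitely many of them, and division by their sum normalizes.\<close>

lemma has_partition_of_unity:
  assumes "compact_space (space_of M)" "Hausdorff_space (space_of M)"
    and op: "\<And>c. c \<in> atlas M \<Longrightarrow> openin (space_of M) (fst c)"
    and cov: "topspace (space_of M) = (\<Union>c\<in>atlas M. fst c)"
  shows "\<exists>Q \<rho>. partition_of_unity M Q \<rho>"
proof -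
  let ?T = "space_of M"
  have reg: "regular_space ?T" "completely_regular_space ?T"
    using assms(1,2) by (auto simp: compact_Hausdorff_imp_regular_space
      compact_Hausdorff_or_regular_imp_normal_space normal_imp_completely_regular_space)
  \<comment> \<open>The closed set \<open>K\<close> is kept next to the bump \<open>h\<close>
    because the closure of the support has to stay inside the chart domain.\<close>
  define good where "good p c K h \<longleftrightarrow> c \<in> atlas M \<and> closedin ?T K \<and> K \<subseteq> fst c \<and>
      continuous_map ?T euclideanreal h \<and> (\<forall>q\<in>topspace ?T. 0 \<le> h q) \<and>
      {q\<in>topspace ?T. h q \<noteq> 0} \<subseteq> K \<and> h p > 0" for p c K h
  have "\<exists>c K h. good p c K h" if p: "p \<in> topspace ?T" for p
  proof -
    obtain c where c: "c \<in> atlas M" "p \<in> fst c" using p cov by auto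
    have "neighbourhood_base_of (closedin ?T) ?T"
      using reg(1) neighbourhood_base_of_closedin by blast
    then obtain U K where UK: "openin ?T U" "closedin ?T K" "p \<in> U" "U \<subseteq> K" "K \<subseteq> fst c"
      unfolding neighbourhood_base_of using op[OF c(1)] c(2) by meson
    have "closedin ?T (topspace ?T - U)" "p \<in> topspace ?T - (topspace ?T - U)"
      using UK p by auto
    \<comment> \<open>\<open>k\<close> vanishes at \<open>p\<close> and equals 1 off
      \<open>U\<close>, so \<open>1 - k\<close> is the desired bump: positive at \<open>p\<close>
      and zero outside \<open>K\<close>.\<close>
    then obtain k :: "'a \<Rightarrow> real" where k: "continuous_map ?T (top_of_set {0..1}) k" "k p = 0" "k ` (topspace ?T - U) \<subseteq> {1}"
      using reg(2) unfolding completely_regular_space_def by metis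
    have k01: "continuous_map ?T euclideanreal k" "\<And>q. q \<in> topspace ?T \<Longrightarrow> k q \<in> {0..1}"
      using k(1) by (auto simp: continuous_map_in_subtopology)
    have "continuous_map ?T euclideanreal (\<lambda>q. 1 - k q)"
      by (intro continuous_intros k01(1))
    moreover have "{q\<in>topspace ?T. 1 - k q \<noteq> 0} \<subseteq> K" using k(3) UK(4) by auto
    ultimately have "good p c K (\<lambda>q. 1 - k q)"
      using c(1) UK k(2) k01(2) by (auto simp: good_def)
    then show ?thesis by blast
  qed
  then obtain c K h where "\<And>p. p \<in> topspace ?T \<Longrightarrow> good p (c p) (K p) (h p)" by metis
  then have cKh: "c p \<in> atlas M \<and> closedin ?T (K p) \<and> K p \<subseteq> fst (c p) \<and>
      continuous_map ?T euclideanreal (h p) \<and> (\<forall>q\<in>topspace ?T. 0 \<le> h p q) \<and>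
      {q\<in>topspace ?T. h p q \<noteq> 0} \<subseteq> K p \<and> h p p > 0" if "p \<in> topspace ?T" for p
    using that unfolding good_def by blast
  define V where "V p = {q\<in>topspace ?T. h p q \<in> {0<..}}" for p
  have "openin ?T (V p)" if "p \<in> topspace ?T" for p
    unfolding V_def using cKh[OF that] by (intro openin_continuous_map_preimage) auto
  moreover have "topspace ?T \<subseteq> \<Union>(V ` topspace ?T)"
    using cKh by (auto simp: V_def)
  ultimately obtain \<F> where "finite \<F>" "\<F> \<subseteq> V ` topspace ?T" "topspace ?T \<subseteq> \<Union>\<F>"
    using assms(1)[unfolded compact_space_alt, rule_format, of "V ` topspace ?T"] by auto
  then obtain P where P: "finite P" "P \<subseteq> topspace ?T" "topspace ?T \<subseteq> \<Union>(V ` P)"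
    by (metis finite_subset_image)
  define H where "H q = (\<Sum>p\<in>P. h p q)" for q
  have Hpos: "H q > 0" if q: "q \<in> topspace ?T" for q
  proof -
    obtain p where "p \<in> P" "q \<in> V p" using P q by auto
    then show ?thesis unfolding H_def using P cKh q
      by (intro sum_pos2[of P p]) (auto simp: V_def)
  qed
  have Hcont: "continuous_map ?T euclideanreal H"
    unfolding H_def using cKh P by (intro continuous_intros) auto
  \<comment> \<open>Different points may have been assigned the same chart. The partition is indexed
    by charts, so bumps with a common chart are added up.\<close>
  define \<rho> where "\<rho> d q = (\<Sum>p\<in>{p\<in>P. c p = d}. h p q) / H q" for d q
  have "partition_of_unity M (c ` P) \<rho>"
    unfolding partition_of_unity_def
  proof (intro conjI ballI)
    show "finite (c ` P)" "c ` P \<subseteq> atlas M" using P cKh by auto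
    fix d assume "d \<in> c ` P"
    show "continuous_map ?T euclideanreal (\<rho> d)"
      unfolding \<rho>_def using cKh P Hcont Hpos
      by (intro continuous_intros) (auto simp: less_imp_neq[symmetric])
    show "0 \<le> \<rho> d q" if "q \<in> topspace ?T" for q
      unfolding \<rho>_def using Hpos[OF that] cKh P that
      by (intro divide_nonneg_pos sum_nonneg) auto
    have "closedin ?T (\<Union>p\<in>{p\<in>P. c p = d}. K p)"
      using P cKh by (intro closedin_Union) auto
    moreover have "{q \<in> topspace ?T. \<rho> d q \<noteq> 0} \<subseteq> (\<Union>p\<in>{p\<in>P. c p = d}. K p)"
    proof clarsimp
      fix q assume q: "q \<in> topspace ?T" "\<rho> d q \<noteq> 0"
      then obtain p where "p \<in> P" "c p = d" "h p q \<noteq> 0"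
        unfolding \<rho>_def by (metis (mono_tags, lifting) div_0 mem_Collect_eq sum.neutral)
      then show "\<exists>p. p \<in> P \<and> c p = d \<and> q \<in> K p" using q cKh P by blast
    qed
    ultimately have "?T closure_of {q \<in> topspace ?T. \<rho> d q \<noteq> 0} \<subseteq> (\<Union>p\<in>{p\<in>P. c p = d}. K p)"
      by (simp add: closure_of_minimal)
    also have "\<dots> \<subseteq> fst d" using cKh P by auto
    finally show "?T closure_of {q \<in> topspace ?T. \<rho> d q \<noteq> 0} \<subseteq> fst d" .
  next
    fix q assume q: "q \<in> topspace ?T"
    have "(\<Sum>d\<in>c ` P. \<rho> d q) = (\<Sum>d\<in>c ` P. \<Sum>p\<in>{p\<in>P. c p = d}. h p q) / H q"
      by (simp add: \<rho>_def sum_divide_distrib)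
    also have "\<dots> = 1"
      using sum.image_gen[OF P(1), of "\<lambda>p. h p q" c] Hpos[OF q] by (simp add: H_def)
    finally show "(\<Sum>d\<in>c ` P. \<rho> d q) = 1" .
  qed
  then show ?thesis by blast
qed

section \<open>Linear algebra at a point\<close>

text \<open>This makes the description in \<open>K_endo\<close> well defined. \<open>G\<close>
  applies the Gram matrix of \<open>g\<close>: positivity gives it trivial kernel, and in finite
  dimension injectivity implies bijectivity.\<close>

lemma riesz_bilinear:
  fixes g :: "'e::euclidean_space \<Rightarrow> 'e \<Rightarrow> real"
  assumes g: "bilinear g" and pos: "\<And>u. u \<noteq> 0 \<Longrightarrow> g u u > 0" and l: "linear l"
  shows "\<exists>!w. \<forall>u. g u w = l u"
proof -
  have gl: "linear (\<lambda>u. g u w)" "linear (g w)" for w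
    using g by (auto simp: bilinear_def)
  define G where "G w = (\<Sum>b\<in>Basis. g b w *\<^sub>R b)" for w
  have G: "linear G"
    unfolding G_def by (rule linearI)
      (simp_all add: linear_add[OF gl(2)] linear_scale[OF gl(2)] scaleR_add_left sum.distrib scaleR_right.sum)
  have eq: "(\<forall>u. g u w = l u) \<longleftrightarrow> G w = (\<Sum>b\<in>Basis. l b *\<^sub>R b)" for w
  proof
    assume "G w = (\<Sum>b\<in>Basis. l b *\<^sub>R b)"
    then have "g b w = l b" if "b \<in> Basis" for b
      using that by (simp add: G_def euclidean_eq_iff[where 'a='e])
    then show "\<forall>u. g u w = l u"
      using linear_eq_on_span[OF gl(1) l, of Basis w] by auto
  qed (simp add: G_def)
  have "w = 0" if "G w = 0" for w
  proof -
    have "g b w = 0" if "b \<in> Basis" for b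
      using \<open>G w = 0\<close> that by (simp add: G_def euclidean_eq_iff[where 'a='e])
    then have "g u w = 0" for u
      using linear_eq_on_span[OF gl(1) linear_zero, of Basis w] by auto
    then show ?thesis using pos[of w] by fastforce
  qed
  then have "inj G" using G by (simp add: linear_injective_0)
  then have "bij G" using G linear_injective_imp_surjective by (auto simp: bij_def)
  then show ?thesis unfolding eq by (auto simp: bij_iff)
qed

lemma linear_I2: "linear I2"
  by (rule linearI) (auto simp: I2_def algebra_simps)

lemma I2_I2 [simp]: "I2 (I2 v) = - v"
  by (simp add: I2_def prod_eq_iff)

lemma linear_complex:
  assumes "linear (D :: complex \<Rightarrow> 'b::real_vector)"
  shows "D v = Re v *\<^sub>R D 1 + Im v *\<^sub>R D \<i>"
proof -
  have "D v = D (Re v *\<^sub>R 1 + Im v *\<^sub>R \<i>)"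
    by (rule arg_cong) (simp add: complex_eq_iff)
  then show ?thesis by (simp only: linear_add[OF assms] linear_scale[OF assms])
qed

text \<open>One tangent space of \<open>X\<close>: \<open>g\<close> is the Hermitian metric,
  \<open>a\<close> the value of \<alpha>, and \<open>K\<close> that of the endomorphism defined by
  \<alpha>. The identity \<open>I_a\<close> is the pointwise form of type (2,0)+(0,2), i.e. of being
  the real part of a complex bilinear form.\<close>

locale hermitian_pair =
  fixes g a :: "complex \<times> complex \<Rightarrow> complex \<times> complex \<Rightarrow> real" and K
  assumes bil_g: "bilinear g" and pos_g: "u \<noteq> 0 \<Longrightarrow> g u u > 0"
    and I_g: "g (I2 u) (I2 v) = g u v"
    and bil_a: "bilinear a" and alt_a: "a u u = 0" and I_a: "a (I2 u) v = a u (I2 v)"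
    and K: "g u (K v) = a u v"
begin

lemma skew_a: "a u v = - a v u"
proof -
  have "a (u + v) (u + v) = 0" by (rule alt_a)
  then show ?thesis
    using alt_a[of u] alt_a[of v] by (simp add: bilinear_ladd[OF bil_a] bilinear_radd[OF bil_a])
qed

lemma g_self_eq_0: "g u u = 0 \<Longrightarrow> u = 0"
  using pos_g[of u] by auto

lemma g_eqI: "(\<And>u. g u v = g u w) \<Longrightarrow> v = w"
  using g_self_eq_0[of "v - w"] by (simp add: bilinear_rsub[OF bil_g])

lemma linear_K: "linear K"
  by (rule linearI; rule g_eqI)
    (simp_all add: K bilinear_radd[OF bil_g] bilinear_radd[OF bil_a] bilinear_rmul[OF bil_g] bilinear_rmul[OF bil_a])

lemma I2_skew_g: "g (I2 u) v = - g u (I2 v)"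
  using I_g[of u "- I2 v"] by (simp add: bilinear_rneg[OF bil_g] linear_neg[OF linear_I2])

text \<open>\<open>I2\<close> is skew for \<open>g\<close> but passes across \<open>a\<close>
  without a sign; this mismatch makes \<open>K\<close> conjugate-linear.\<close>

lemma K_I2: "K (I2 v) = - I2 (K v)"
  by (rule g_eqI) (simp add: K bilinear_rneg[OF bil_g] flip: I2_skew_g I_a)

lemma a_I2_self: "a u (I2 u) = 0"
  using I_a[of u u] skew_a[of u "I2 u"] by simp

definition "B v = v + I2 (K v)"

lemma linear_B: "linear B"
  unfolding B_def by (intro linear_compose_add linear_ident linear_compose[OF linear_K linear_I2, unfolded o_def])

text \<open>A kernel vector satisfies \<open>v = - I2 (K v)\<close>, whence
  \<open>g v v = a (I2 v) v = 0\<close>. Surjectivity is what turns \<open>inv B\<close> into a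
  genuine right inverse.\<close>

lemma surj_B: "surj B"
proof -
  have "v = 0" if "B v = 0" for v
  proof -
    have "v = - I2 (K v)" using that by (simp add: B_def eq_neg_iff_add_eq_0)
    then have "g v v = g v (- I2 (K v))" by metis
    also have "\<dots> = g (I2 v) (K v)" by (simp add: I2_skew_g bilinear_rneg[OF bil_g])
    also have "\<dots> = 0" using a_I2_self[of v] by (simp add: K I_a)
    finally show ?thesis by (rule g_self_eq_0)
  qed
  then show ?thesis
    using linear_B linear_injective_0 linear_injective_imp_surjective by blast
qed

context
  fixes D :: "complex \<Rightarrow> complex \<times> complex"
  assumes D: "linear D"
    and hol: "\<And>v. (1/2) *\<^sub>R (D v + (inv B \<circ> I2 \<circ> B) (D (I1 v))) = 0"
begin

text \<open>Applying \<open>B\<close> to the holomorphicity equation removes \<open>inv B\<close>,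
  and conjugate-linearity of \<open>K\<close> sorts the terms. The result is twice the equation
  \<open>dbar f = K \<circ> \<partial>f \<circ> j\<close>, evaluated on the vector
  \<open>1\<close>.\<close>

lemma dbar_eq: "D 1 + I2 (D \<i>) = K (D \<i> + I2 (D 1))"
proof -
  have "D 1 = - inv B (I2 (B (D \<i>)))"
    using hol[of 1] by (simp add: I1_def eq_neg_iff_add_eq_0)
  then have "B (D 1) = - I2 (B (D \<i>))"
    using surj_B by (simp add: linear_neg[OF linear_B] surj_f_inv_f)
  then show ?thesis
    by (simp add: B_def linear_add[OF linear_I2] linear_add[OF linear_K] K_I2 algebra_simps)
qed

text \<open>If \<open>D\<close> is the differential of \<open>f\<close>, then \<open>D 1 + I2 (D \<i>)\<close> is twice the value of
  \<open>dbar f\<close> on the vector \<open>1\<close>.\<close>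

lemma energy: "a (D 1) (D \<i>) = g (D 1 + I2 (D \<i>)) (D 1 + I2 (D \<i>)) / 2"
proof -
  define p q where "p = D \<i> + I2 (D 1)" and "q = D 1 + I2 (D \<i>)"
  \<comment> \<open>\<open>q\<close> is twice \<open>dbar f\<close> on \<open>1\<close> and
    \<open>p\<close> is twice \<open>\<partial>f\<close> on \<open>\<i>\<close>, so
    \<open>q = K p\<close>, and the defining property of \<open>K\<close> turns the square norm of
    \<open>q\<close> into \<open>a q p\<close>.\<close>
  have "g q q = a q p" using dbar_eq by (simp add: K p_def q_def)
  also have "\<dots> = a (D 1) (D \<i>) + a (D 1) (I2 (D 1)) + a (I2 (D \<i>)) (D \<i>) + a (I2 (D \<i>)) (I2 (D 1))"
    by (simp add: p_def q_def bilinear_ladd[OF bil_a] bilinear_radd[OF bil_a])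
  also have "\<dots> = 2 * a (D 1) (D \<i>)"
    using skew_a[of "D \<i>" "D 1"] by (simp add: a_I2_self I_a bilinear_rneg[OF bil_a])
  finally show ?thesis by (simp add: q_def)
qed

text \<open>By \<open>energy\<close>, a vanishing pullback forces \<open>dbar f\<close> to vanish on
  \<open>1\<close>, hence on all vectors since \<open>D\<close> is real linear. Then the other side
  of \<open>dbar_eq\<close> vanishes as well, and it is \<open>K\<close> of twice
  \<open>D \<i>\<close>.\<close>

lemma dbar_zero:
  assumes "a (D 1) (D \<i>) = 0"
  shows "D v + I2 (D (I1 v)) = 0" "K (D \<i>) = 0"
proof -
  have q: "D 1 + I2 (D \<i>) = 0" using assms energy by (intro g_self_eq_0) simp
  then have D1: "D 1 = - I2 (D \<i>)" by (simp add: eq_neg_iff_add_eq_0)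
  note v = linear_complex[OF D]
  have "D (I1 v) = - Im v *\<^sub>R D 1 + Re v *\<^sub>R D \<i>"
    using v[of "I1 v"] by (simp add: I1_def)
  then show "D v + I2 (D (I1 v)) = 0"
    by (simp add: v[of v] D1 linear_add[OF linear_I2] linear_scale[OF linear_I2]
        linear_neg[OF linear_I2] linear_diff[OF linear_I2])
  have "0 = K (D \<i> + I2 (D 1))" using dbar_eq q by simp
  also have "\<dots> = K (2 *\<^sub>R D \<i>)" by (simp add: D1 linear_neg[OF linear_I2] scaleR_2)
  finally show "K (D \<i>) = 0" by (simp add: linear_scale[OF linear_K])
qed

end
end

section \<open>Charts and local expressions\<close>

lemma point_of_coord:
  "is_chart T c \<Longrightarrow> p \<in> fst c \<Longrightarrow> point_of c (snd c p) = p"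
  unfolding is_chart_def point_of_def
  by (metis homeomorphic_imp_injective_map inf.absorb_iff2 inv_into_f_f openin_subset topspace_subtopology)

lemma coord_point_of: "x \<in> coords c \<Longrightarrow> snd c (point_of c x) = x"
  by (simp add: coords_def point_of_def f_inv_into_f)

lemma point_of_mem: "x \<in> coords c \<Longrightarrow> point_of c x \<in> fst c"
  by (simp add: coords_def point_of_def inv_into_into)

lemma coord_mem: "p \<in> fst c \<Longrightarrow> snd c p \<in> coords c"
  by (simp add: coords_def)

lemma open_coord_image:
  assumes c: "is_chart T c" and U: "openin T U" "U \<subseteq> fst c"
  shows "open (snd c ` U)"
proof -
  have "open_map (subtopology T (fst c)) (top_of_set (coords c)) (snd c)" "open (coords c)"
    using c by (auto simp: is_chart_def homeomorphic_imp_open_map)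
  moreover have "openin (subtopology T (fst c)) U"
    using U by (auto simp: openin_subtopology)
  ultimately show ?thesis
    unfolding open_map_def using openin_open_trans by blast
qed

lemma openin_point_of_image:
  assumes c: "is_chart T c" and W: "open W" "W \<subseteq> coords c"
  shows "openin T (point_of c ` W)"
proof -
  have cont: "continuous_map (subtopology T (fst c)) (top_of_set (coords c)) (snd c)" and op: "openin T (fst c)"
    using c by (auto simp: is_chart_def homeomorphic_imp_continuous_map)
  have eq: "point_of c ` W = {p \<in> topspace (subtopology T (fst c)). snd c p \<in> W}"
  proof (intro equalityI subsetI)
    fix p assume "p \<in> point_of c ` W"
    then obtain x where "x \<in> W" "p = point_of c x" by blast
    moreover have "x \<in> coords c" using \<open>x \<in> W\<close> W by blast
    ultimately show "p \<in> {p \<in> topspace (subtopology T (fst c)). snd c p \<in> W}"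
      using point_of_mem[of x c] openin_subset[OF op] by (auto simp: coord_point_of)
  next
    fix p assume "p \<in> {p \<in> topspace (subtopology T (fst c)). snd c p \<in> W}"
    then show "p \<in> point_of c ` W"
      using point_of_coord[OF c, of p] by (auto intro: rev_image_eqI[of "snd c p"])
  qed
  have "openin (top_of_set (coords c)) W"
    using W open_subset by blast
  then have "openin (subtopology T (fst c)) (point_of c ` W)"
    unfolding eq by (rule openin_continuous_map_preimage[OF cont])
  then show ?thesis using op openin_trans_full by blast
qed

lemma continuous_map_point_of:
  assumes "is_chart T c"
  shows "continuous_map (top_of_set (coords c)) T (point_of c)"
proof -
  obtain k where k: "homeomorphic_maps (subtopology T (fst c)) (top_of_set (coords c)) (snd c) k"
    using assms by (auto simp: is_chart_def homeomorphic_map_maps)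
  then have "continuous_map (top_of_set (coords c)) (subtopology T (fst c)) k"
    and k2: "\<And>x. x \<in> coords c \<Longrightarrow> k x \<in> fst c \<and> snd c (k x) = x"
    by (auto simp: homeomorphic_maps_def continuous_map_def)
  then have "continuous_map (top_of_set (coords c)) T k"
    by (simp add: continuous_map_in_subtopology)
  moreover have "k x = point_of c x" if "x \<in> coords c" for x
    using point_of_coord[OF assms, of "k x"] k2[OF that] by simp
  ultimately show ?thesis by (rule continuous_map_eq) simp
qed

lemma open_overlap:
  assumes "is_chart T c" "is_chart T' d" "continuous_map T T' F"
  shows "open (snd c ` (fst c \<inter> F -` fst d))"
proof -
  have op: "openin T (fst c)" "openin T' (fst d)" using assms by (auto simp: is_chart_def)
  have "fst c \<inter> F -` fst d = fst c \<inter> {p \<in> topspace T. F p \<in> fst d}"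
    using openin_subset[OF op(1)] by auto
  then have "openin T (fst c \<inter> F -` fst d)"
    using op assms(3) openin_continuous_map_preimage by fastforce
  then show ?thesis using open_coord_image[OF assms(1)] by blast
qed

section \<open>Differentials in charts, the chain rule and the pullback of 2-forms\<close>

lemma local_expr_coord:
  "is_chart T c \<Longrightarrow> s \<in> fst c \<Longrightarrow> local_expr c d F (snd c s) = snd d (F s)"
  by (simp add: local_expr_def point_of_coord)

lemma complex_manifoldD:
  assumes "complex_manifold i M" "c \<in> atlas M"
  shows "is_chart (space_of M) c" "openin (space_of M) (fst c)" "open (coords c)"
  using assms by (auto simp: complex_manifold_def is_chart_def)

lemma transition_differentiable:
  assumes "complex_manifold i M" "c \<in> atlas M" "d \<in> atlas M" "p \<in> fst c" "p \<in> fst d"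
  shows "transition c d differentiable at (snd c p)"
    "frechet_derivative (transition c d) (at (snd c p)) (i v) =
      i (frechet_derivative (transition c d) (at (snd c p)) v)"
  using assms by (auto simp: complex_manifold_def holo_on_def)

lemma local_expr_differentiable:
  assumes "smooth_map M N F" "c \<in> atlas M" "d \<in> atlas N"
  shows "p \<in> fst c \<Longrightarrow> F p \<in> fst d \<Longrightarrow> local_expr c d F differentiable at (snd c p)"
    "continuous_on (snd c ` (fst c \<inter> F -` fst d)) (local_expr c d F)"
    "continuous_on (snd c ` (fst c \<inter> F -` fst d)) (\<lambda>x. frechet_derivative (local_expr c d F) (at x) v)"
proof -
  have sm: "Ck_on k (local_expr c d F) (snd c ` (fst c \<inter> F -` fst d))" for k
    using assms by (auto simp: smooth_map_def smooth_on_def)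
  show "local_expr c d F differentiable at (snd c p)" if "p \<in> fst c" "F p \<in> fst d"
    using sm[of "Suc 0"] that by auto
  show "continuous_on (snd c ` (fst c \<inter> F -` fst d)) (local_expr c d F)"
    using sm[of 0] by simp
  show "continuous_on (snd c ` (fst c \<inter> F -` fst d)) (\<lambda>x. frechet_derivative (local_expr c d F) (at x) v)"
    using sm[of "Suc 0"] by simp
qed

text \<open>The two local expressions are related by the transition map only on the overlap; since
  this is open, the chain rule at the point still applies.\<close>

lemma local_expr_change_target:
  assumes M: "complex_manifold i M" and N: "complex_manifold i' N" and F: "smooth_map M N F"
    and c: "c \<in> atlas M" and d: "d \<in> atlas N" "d' \<in> atlas N"
    and s: "s \<in> fst c" "F s \<in> fst d" "F s \<in> fst d'"
  shows "frechet_derivative (local_expr c d' F) (at (snd c s)) v =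
    frechet_derivative (transition d d') (at (snd d (F s)))
      (frechet_derivative (local_expr c d F) (at (snd c s)) v)"
proof -
  note ch = complex_manifoldD(1)[OF M c] complex_manifoldD(1)[OF N d(1)]
  let ?W = "snd c ` (fst c \<inter> F -` fst d)"
  have W: "open ?W" using ch F by (intro open_overlap) (auto simp: smooth_map_def)
  have "(transition d d' \<circ> local_expr c d F has_derivative
      frechet_derivative (transition d d') (at (snd d (F s))) \<circ>
      frechet_derivative (local_expr c d F) (at (snd c s))) (at (snd c s))"
    using local_expr_differentiable(1)[OF F c d(1) s(1,2)] transition_differentiable(1)[OF N d s(2,3)]
    by (intro diff_chain_at) (auto simp: local_expr_coord[OF ch(1) s(1)] frechet_derivative_works)
  then have "(local_expr c d' F has_derivative
      frechet_derivative (transition d d') (at (snd d (F s))) \<circ>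
      frechet_derivative (local_expr c d F) (at (snd c s))) (at (snd c s))"
    by (rule has_derivative_transform_within_open[OF _ W])
      (use s ch in \<open>auto simp: local_expr_coord transition_def point_of_coord\<close>)
  then show ?thesis by (simp flip: frechet_derivative_at)
qed

text \<open>The integral argument yields vanishing in one chart around a point; this chain rule
  carries it to every other chart of the source.\<close>

lemma local_expr_change_source:
  assumes M: "complex_manifold i M" and N: "complex_manifold i' N" and F: "smooth_map M N F"
    and c: "c \<in> atlas M" "c' \<in> atlas M" and d: "d \<in> atlas N"
    and s: "s \<in> fst c" "s \<in> fst c'" "F s \<in> fst d"
  shows "frechet_derivative (local_expr c' d F) (at (snd c' s)) v =
    frechet_derivative (local_expr c d F) (at (snd c s))
      (frechet_derivative (transition c' c) (at (snd c' s)) v)"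
proof -
  note ch = complex_manifoldD(1)[OF M c(1)] complex_manifoldD(1)[OF M c(2)]
  let ?W = "snd c' ` (fst c' \<inter> fst c)"
  have W: "open ?W"
    by (intro open_coord_image[OF ch(2)] openin_Int complex_manifoldD(2)[OF M] c) auto
  have "transition c' c (snd c' s) = snd c s"
    using ch s by (simp add: transition_def point_of_coord)
  then have "(local_expr c d F \<circ> transition c' c has_derivative
      frechet_derivative (local_expr c d F) (at (snd c s)) \<circ>
      frechet_derivative (transition c' c) (at (snd c' s))) (at (snd c' s))"
    using local_expr_differentiable(1)[OF F c(1) d s(1,3)] transition_differentiable(1)[OF M c(2,1) s(2,1)]
    by (intro diff_chain_at) (auto simp: frechet_derivative_works)
  then have "(local_expr c' d F has_derivative
      frechet_derivative (local_expr c d F) (at (snd c s)) \<circ>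
      frechet_derivative (transition c' c) (at (snd c' s))) (at (snd c' s))"
    by (rule has_derivative_transform_within_open[OF _ W])
      (use s ch in \<open>auto simp: local_expr_coord transition_def point_of_coord\<close>)
  then show ?thesis by (simp flip: frechet_derivative_at)
qed

text \<open>\<open>pullback_coeff\<close> chooses its target chart by \<open>SOME\<close>. Under a
  change of chart the transformation law of the tensor and the chain rule cancel, so any chart
  around the image point gives the same value.\<close>

lemma pullback_coeff_chart:
  assumes M: "complex_manifold i M" and N: "complex_manifold i' N" and F: "smooth_map M N F"
    and \<omega>: "tensor2 N \<omega>" and c: "c \<in> atlas M" and d: "d \<in> atlas N"
    and s: "s \<in> fst c" "F s \<in> fst d"
  shows "pullback_coeff N F \<omega> c (snd c s) =
    \<omega> d (snd d (F s)) (frechet_derivative (local_expr c d F) (at (snd c s)) 1)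
      (frechet_derivative (local_expr c d F) (at (snd c s)) \<i>)"
proof -
  note ch = complex_manifoldD(1)[OF M c]
  define d' where "d' = (SOME d'. d' \<in> atlas N \<and> F (point_of c (snd c s)) \<in> fst d')"
  have "d' \<in> atlas N \<and> F (point_of c (snd c s)) \<in> fst d'"
    unfolding d'_def by (rule someI[of _ d]) (use d s ch in \<open>auto simp: point_of_coord\<close>)
  then have d': "d' \<in> atlas N" "F s \<in> fst d'" using s ch by (auto simp: point_of_coord)
  have tr: "\<omega> d (snd d (F s)) u v = \<omega> d' (snd d' (F s))
      (frechet_derivative (transition d d') (at (snd d (F s))) u)
      (frechet_derivative (transition d d') (at (snd d (F s))) v)" for u v
    using \<omega> d d' s unfolding tensor2_def Let_def by blast
  show ?thesis
    unfolding tr local_expr_change_target[OF M N F c d d'(1) s d'(2), symmetric]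
    by (simp add: pullback_coeff_def Let_def local_expr_coord[OF ch s(1)] flip: d'_def)
qed

section \<open>Integrals of nonnegative functions\<close>

text \<open>The choice inside \<open>manifold_integral\<close> does not involve the integrand, so
  one partition serves for all integrands.\<close>

lemma manifold_integral_partition:
  assumes M: "complex_manifold i M" and comp: "compact_space (space_of M)"
  obtains Q \<rho> where "partition_of_unity M Q \<rho>"
    "\<And>\<mu>. manifold_integral M \<mu> = (\<Sum>c\<in>Q. LINT x:coords c|lborel. \<rho> c (point_of c x) * \<mu> c x)"
proof -
  have "\<exists>Q \<rho>. partition_of_unity M Q \<rho>"
    using M comp by (intro has_partition_of_unity) (auto simp: complex_manifold_def is_chart_def)
  then have "\<exists>z. (\<lambda>(Q, \<rho>). partition_of_unity M Q \<rho>) z" by auto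
  then have "(\<lambda>(Q, \<rho>). partition_of_unity M Q \<rho>) (SOME (Q, \<rho>). partition_of_unity M Q \<rho>)"
    by (rule someI_ex)
  then obtain Q \<rho> where eq: "(SOME (Q, \<rho>). partition_of_unity M Q \<rho>) = (Q, \<rho>)"
    and Q: "partition_of_unity M Q \<rho>"
    by (metis (no_types, lifting) case_prodE)
  show ?thesis
    by (rule that[OF Q]) (simp add: manifold_integral_def eq)
qed

text \<open>The summands are integrals of nonnegative functions, so each of them vanishes, and a
  continuous nonnegative function with zero integral is zero. The chart obtained is one whose weight
  is positive at \<open>p\<close>; as \<mu> obeys no assumed transformation law, other charts are
  not covered.\<close>

lemma manifold_integral_eq_0D:
  fixes M :: "('p, 'e::euclidean_space) manifold"
  assumes M: "complex_manifold i M" and comp: "compact_space (space_of M)"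
    and cont: "\<And>c. c \<in> atlas M \<Longrightarrow> continuous_on (coords c) (\<mu> c)"
    and nn: "\<And>c x. c \<in> atlas M \<Longrightarrow> x \<in> coords c \<Longrightarrow> \<mu> c x \<ge> 0"
    and int0: "manifold_integral M \<mu> = 0" and p: "p \<in> topspace (space_of M)"
  shows "\<exists>c\<in>atlas M. p \<in> fst c \<and> \<mu> c (snd c p) = 0"
proof -
  let ?T = "space_of M"
  obtain Q \<rho> where "partition_of_unity M Q \<rho>"
    and eq: "\<And>\<mu>. manifold_integral M \<mu> = (\<Sum>c\<in>Q. LINT x:coords c|lborel. \<rho> c (point_of c x) * \<mu> c x)"
    using manifold_integral_partition[OF M comp] by blast
  then have Q: "finite Q" "Q \<subseteq> atlas M"
    and \<rho>: "\<And>c. c \<in> Q \<Longrightarrow> continuous_map ?T euclideanreal (\<rho> c)"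
      "\<And>c q. c \<in> Q \<Longrightarrow> q \<in> topspace ?T \<Longrightarrow> 0 \<le> \<rho> c q"
      "\<And>c. c \<in> Q \<Longrightarrow> ?T closure_of {q \<in> topspace ?T. \<rho> c q \<noteq> 0} \<subseteq> fst c"
      "(\<Sum>c\<in>Q. \<rho> c p) = 1"
    using p by (auto simp: partition_of_unity_def)
  define \<phi> where "\<phi> c x = indicator (coords c) x *\<^sub>R (\<rho> c (point_of c x) * \<mu> c x)" for c x
  have sum0: "(\<Sum>c\<in>Q. LINT x|lborel. \<phi> c x) = 0"
    using int0 by (simp add: eq set_lebesgue_integral_def \<phi>_def)
  have nn\<phi>: "\<phi> c x \<ge> 0" if "c \<in> Q" for c x
  proof (cases "x \<in> coords c")
    case True
    then have "point_of c x \<in> topspace ?T"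
      using point_of_mem[OF True] openin_subset[OF complex_manifoldD(2)[OF M, of c]] that Q by auto
    then show ?thesis using \<rho>(2)[OF that] nn[of c x] True that Q by (auto simp: \<phi>_def)
  qed (simp add: \<phi>_def)
  have cont\<phi>: "continuous_on (coords c) (\<lambda>x. \<rho> c (point_of c x) * \<mu> c x)" if "c \<in> Q" for c
  proof -
    have "continuous_map (top_of_set (coords c)) euclideanreal (\<rho> c \<circ> point_of c)"
      using that Q
      by (intro continuous_map_compose[OF continuous_map_point_of[OF complex_manifoldD(1)[OF M]]] \<rho>(1)) auto
    then show ?thesis
      using cont[of c] that Q by (intro continuous_on_mult) (auto simp: o_def)
  qed
  \<comment> \<open>A non-integrable function has integral 0 by convention, so integrability must
    come before any conclusion about vanishing. It holds because the support of the weight is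
    compact inside the chart.\<close>
  have int\<phi>: "integrable lborel (\<phi> c)" if "c \<in> Q" for c
  proof -
    have c: "c \<in> atlas M" using that Q by blast
    define L where "L = ?T closure_of {q \<in> topspace ?T. \<rho> c q \<noteq> 0}"
    have "compactin ?T L" unfolding L_def by (intro closedin_compact_space comp closedin_closure_of)
    then have "compactin (subtopology ?T (fst c)) L"
      using \<rho>(3)[OF that] by (auto simp: compactin_subtopology L_def)
    then have "compactin (top_of_set (coords c)) (snd c ` L)"
      using complex_manifoldD(1)[OF M c] unfolding is_chart_def
      by (meson homeomorphic_imp_continuous_map image_compactin)
    then have L: "compact (snd c ` L)" "snd c ` L \<subseteq> coords c"
      by (auto simp: compactin_subtopology)
    have "\<phi> c x = indicator (snd c ` L) x *\<^sub>R (\<rho> c (point_of c x) * \<mu> c x)" for x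
    proof (cases "x \<in> coords c \<and> x \<notin> snd c ` L")
      case True
      then have x: "point_of c x \<notin> L" "point_of c x \<in> topspace ?T"
        using coord_point_of[of x c] point_of_mem[of x c] openin_subset[OF complex_manifoldD(2)[OF M c]] by force+
      have "{q \<in> topspace ?T. \<rho> c q \<noteq> 0} \<subseteq> L"
        unfolding L_def by (rule closure_of_subset) auto
      then have "\<rho> c (point_of c x) = 0" using x by auto
      then show ?thesis by (simp add: \<phi>_def)
    qed (use L in \<open>auto simp: \<phi>_def indicator_def\<close>)
    then show ?thesis
      using borel_integrable_compact[OF L(1) continuous_on_subset[OF cont\<phi>[OF that] L(2)]]
      by (simp cong: Bochner_Integration.integrable_cong)
  qed
  obtain c where c: "c \<in> Q" "\<rho> c p \<noteq> 0"
    using \<rho>(4) by (metis sum.neutral zero_neq_one)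
  have "p \<in> ?T closure_of {q \<in> topspace ?T. \<rho> c q \<noteq> 0}"
    using closure_of_subset[of "{q \<in> topspace ?T. \<rho> c q \<noteq> 0}" ?T] p c by auto
  then have pc: "p \<in> fst c" using \<rho>(3)[OF c(1)] by blast
  have "(LINT x|lborel. \<phi> c x) = 0"
    using sum0 Q(1) c nn\<phi> by (subst (asm) sum_nonneg_eq_0_iff) (auto intro!: integral_nonneg)
  then have "AE x in lborel. \<phi> c x = 0"
    using int\<phi>[OF c(1)] nn\<phi>[OF c(1)] by (simp add: integral_nonneg_eq_0_iff_AE)
  then obtain N where N: "N \<in> null_sets lborel" "{x. \<phi> c x \<noteq> 0} \<subseteq> N"
    by (auto simp: eventually_ae_filter)
  have "negligible {x. \<phi> c x \<noteq> 0}"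
    using N by (meson negligible_iff_null_sets negligible_subset null_sets_completionI)
  \<comment> \<open>An open null set is empty, which upgrades vanishing almost everywhere to
    vanishing everywhere.\<close>
  moreover have "open {x. \<phi> c x \<noteq> 0}"
  proof -
    have "open (coords c \<inter> (\<lambda>x. \<rho> c (point_of c x) * \<mu> c x) -` (- {0}))"
      using cont\<phi>[OF c(1)] complex_manifoldD(3)[OF M, of c] c Q by (intro continuous_open_preimage) auto
    also have "coords c \<inter> (\<lambda>x. \<rho> c (point_of c x) * \<mu> c x) -` (- {0}) = {x. \<phi> c x \<noteq> 0}"
      by (auto simp: \<phi>_def indicator_def)
    finally show ?thesis .
  qed
  ultimately have "\<phi> c (snd c p) = 0"
    using open_not_negligible by blast
  then have "\<mu> c (snd c p) = 0"
    using c pc Q point_of_coord[OF complex_manifoldD(1)[OF M, of c]] coord_mem[OF pc]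
    by (auto simp: \<phi>_def)
  then show ?thesis using c pc Q by blast
qed

lemma manifold_integral_0:
  assumes M: "complex_manifold i M" and comp: "compact_space (space_of M)"
    and 0: "\<And>c x. c \<in> atlas M \<Longrightarrow> x \<in> coords c \<Longrightarrow> \<mu> c x = 0"
  shows "manifold_integral M \<mu> = 0"
proof -
  obtain Q \<rho> where "partition_of_unity M Q \<rho>"
    and eq: "\<And>\<mu>. manifold_integral M \<mu> = (\<Sum>c\<in>Q. LINT x:coords c|lborel. \<rho> c (point_of c x) * \<mu> c x)"
    using manifold_integral_partition[OF M comp] by blast
  then have "Q \<subseteq> atlas M" by (simp add: partition_of_unity_def)
  then have "(\<lambda>x. indicator (coords c) x *\<^sub>R (\<rho> c (point_of c x) * \<mu> c x)) = (\<lambda>_. 0)" if "c \<in> Q" for c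
    using 0[of c] that by (auto simp: fun_eq_iff indicator_def)
  then have "(LINT x:coords c|lborel. \<rho> c (point_of c x) * \<mu> c x) = 0" if "c \<in> Q" for c
    unfolding set_lebesgue_integral_def using that by (simp only: integral_zero)
  then show ?thesis unfolding eq by simp
qed

section \<open>Real parts of holomorphic 2-forms\<close>

lemma H20_local:
  assumes "\<phi> \<in> H20 X" "c \<in> atlas X"
  obtains h where "holo_on I2 I1 (coords c) h"
    "\<And>x u v. x \<in> coords c \<Longrightarrow> \<phi> c x u v = h x * (fst u * snd v - snd u * fst v)"
  using assms unfolding H20_def by blast

lemma H20_eq_0: "\<phi> \<in> H20 X \<Longrightarrow> c \<notin> atlas X \<or> x \<notin> coords c \<Longrightarrow> \<phi> c x u v = 0"
  unfolding H20_def two_form_def tensor2_def by (metis (mono_tags, lifting) mem_Collect_eq)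

text \<open>Evaluation on \<open>(1, 0), (0, 1)\<close> and on \<open>(\<i>, 0), (0, 1)\<close>
  reads off the real part of the coefficient and minus its imaginary part. This uniqueness makes the
  description in \<open>holomorphic_form_of\<close> legitimate.\<close>

lemma H20_eqI:
  assumes "\<phi> \<in> H20 X" "\<psi> \<in> H20 X" and Re: "\<And>c x u v. Re (\<phi> c x u v) = Re (\<psi> c x u v)"
  shows "\<phi> = \<psi>"
proof (intro ext)
  fix c x u v
  show "\<phi> c x u v = \<psi> c x u v"
  proof (cases "c \<in> atlas X \<and> x \<in> coords c")
    case True
    obtain h where h: "\<And>u v. \<phi> c x u v = h x * (fst u * snd v - snd u * fst v)"
      using H20_local[OF assms(1)] True by metis
    obtain k where k: "\<And>u v. \<psi> c x u v = k x * (fst u * snd v - snd u * fst v)"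
      using H20_local[OF assms(2)] True by metis
    have "h x = k x"
      using Re[of c x "(1, 0)" "(0, 1)"] Re[of c x "(\<i>, 0)" "(0, 1)"] h k by (simp add: complex_eq_iff)
    then show ?thesis using h k by simp
  qed (use assms H20_eq_0 in metis)
qed

lemma calH_E:
  assumes "\<alpha> \<in> calH X"
  obtains \<phi> where "\<phi> \<in> H20 X" "holomorphic_form_of X \<alpha> = \<phi>" "\<And>c x u v. \<alpha> c x u v = 2 * Re (\<phi> c x u v)"
proof -
  have iff: "real_part_form \<phi> \<alpha> \<longleftrightarrow> (\<forall>c x u v. \<alpha> c x u v = 2 * Re (\<phi> c x u v))" for \<phi>
    by (simp add: real_part_form_def complex_eq_iff)
  obtain \<phi> where \<phi>: "\<phi> \<in> H20 X" "real_part_form \<phi> \<alpha>" using assms by (auto simp: calH_def)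
  have "holomorphic_form_of X \<alpha> = \<phi>"
    unfolding holomorphic_form_of_def
    by (rule the_equality) (use \<phi> in \<open>auto intro!: H20_eqI simp: iff\<close>)
  then show ?thesis using that \<phi> iff by blast
qed

section \<open>Locality of derivatives and the local equation of the zero divisor\<close>

lemma frechet_derivative_cong_open:
  assumes "open S" "x \<in> S" "\<And>y. y \<in> S \<Longrightarrow> f y = g y" "f differentiable at x"
  shows "g differentiable at x" "frechet_derivative g (at x) = frechet_derivative f (at x)"
proof -
  have "(f has_derivative frechet_derivative f (at x)) (at x)"
    using assms(4) by (simp add: frechet_derivative_works)
  then have "(g has_derivative frechet_derivative f (at x)) (at x)"
    by (rule has_derivative_transform_within_open[OF _ assms(1,2,3)])
  then show "g differentiable at x" "frechet_derivative g (at x) = frechet_derivative f (at x)"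
    by (auto simp: differentiable_def dest: frechet_derivative_at)
qed

lemma Ck_on_cong:
  assumes "open S" "\<And>x. x \<in> S \<Longrightarrow> f x = g x" "Ck_on k f S"
  shows "Ck_on k g S"
  using assms(2,3)
proof (induction k arbitrary: f g)
  case 0
  then show ?case by (simp cong: continuous_on_cong)
next
  case (Suc k)
  note * = frechet_derivative_cong_open[OF assms(1) _ Suc.prems(1)]
  have "Ck_on k (\<lambda>x. frechet_derivative g (at x) v) S" for v
    by (rule Suc.IH[of "\<lambda>x. frechet_derivative f (at x) v"]) (use * Suc.prems(2) in auto)
  then show ?case using * Suc.prems(2) by simp
qed

text \<open>On the range of the chart the local equation coincides with the holomorphic coefficient
  provided by \<open>H20\<close>; as this range is open, the derivatives coincide too.\<close>

lemma zero_divisor_local: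
  assumes X: "complex_manifold I2 X" and \<alpha>: "\<alpha> \<in> calH X" and c: "c \<in> atlas X"
  shows "holo_on I2 I1 (coords c) (zero_divisor X \<alpha> c)"
    and "x \<in> coords c \<Longrightarrow> \<alpha> c x u v = 2 * Re (zero_divisor X \<alpha> c x * (fst u * snd v - snd u * fst v))"
proof -
  obtain \<phi> where \<phi>: "\<phi> \<in> H20 X" "holomorphic_form_of X \<alpha> = \<phi>" "\<And>c x u v. \<alpha> c x u v = 2 * Re (\<phi> c x u v)"
    using calH_E[OF \<alpha>] by metis
  obtain h where h: "holo_on I2 I1 (coords c) h"
    "\<And>x u v. x \<in> coords c \<Longrightarrow> \<phi> c x u v = h x * (fst u * snd v - snd u * fst v)"
    using H20_local[OF \<phi>(1) c] by metis
  have eq: "zero_divisor X \<alpha> c x = h x" if "x \<in> coords c" for x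
    using h(2)[OF that] \<phi>(2) by (simp add: zero_divisor_def)
  show "holo_on I2 I1 (coords c) (zero_divisor X \<alpha> c)"
    using h(1) frechet_derivative_cong_open[OF complex_manifoldD(3)[OF X c], of _ h "zero_divisor X \<alpha> c"] eq
    by (simp add: holo_on_def)
  show "\<alpha> c x u v = 2 * Re (zero_divisor X \<alpha> c x * (fst u * snd v - snd u * fst v))" if "x \<in> coords c"
    by (simp add: \<phi>(3) eq[OF that] h(2)[OF that])
qed

section \<open>Elements of \<open>calH\<close> as closed 2-forms, and their wedge with
  (1,1)-forms\<close>

lemma frechet_derivative_bounded_linear:
  assumes "bounded_linear L" "f differentiable at x"
  shows "frechet_derivative (\<lambda>x. L (f x)) (at x) v = L (frechet_derivative f (at x) v)"
    "(\<lambda>x. L (f x)) differentiable at x"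
proof -
  have "((\<lambda>x. L (f x)) has_derivative (\<lambda>v. L (frechet_derivative f (at x) v))) (at x)"
    using assms(2) by (intro bounded_linear.has_derivative[OF assms(1)]) (simp add: frechet_derivative_works)
  then show "frechet_derivative (\<lambda>x. L (f x)) (at x) v = L (frechet_derivative f (at x) v)"
    "(\<lambda>x. L (f x)) differentiable at x"
    by (auto simp: differentiable_def simp flip: frechet_derivative_at)
qed

lemma Ck_on_bounded_linear:
  assumes "bounded_linear L" "open S" "Ck_on k f S"
  shows "Ck_on k (\<lambda>x. L (f x)) S"
  using assms(3)
proof (induction k arbitrary: f)
  case 0
  then show ?case using assms(1) by (simp add: bounded_linear.continuous_on)
next
  case (Suc k)
  have "Ck_on k (\<lambda>x. frechet_derivative (\<lambda>x. L (f x)) (at x) v) S" for v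
    by (rule Ck_on_cong[OF assms(2) _ Suc.IH[of "\<lambda>x. frechet_derivative f (at x) v"]])
      (use Suc.prems in \<open>auto simp: frechet_derivative_bounded_linear[OF assms(1)]\<close>)
  then show ?case using Suc.prems by (simp add: frechet_derivative_bounded_linear[OF assms(1)])
qed

lemma bounded_linear_Re_double: "bounded_linear (\<lambda>z. 2 * Re z)"
  by (intro bounded_linear_const_mult bounded_linear_Re)

lemma calH_tensor2:
  assumes X: "complex_manifold I2 X" and "\<alpha> \<in> calH X"
  shows "tensor2 X \<alpha>" "two_form X \<alpha>"
proof -
  obtain \<phi> where \<phi>: "\<phi> \<in> H20 X" and \<alpha>: "\<And>c x u v. \<alpha> c x u v = 2 * Re (\<phi> c x u v)"
    using calH_E[OF assms(2)] by metis
  have t: "tensor2 X \<phi>" and alt: "\<And>c x v. \<phi> c x v v = 0"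
    using \<phi> by (auto simp: H20_def two_form_def)
  have lin: "linear (\<lambda>z::complex. 2 * Re z)"
    using bounded_linear_Re_double by (rule bounded_linear.linear)
  show "tensor2 X \<alpha>"
    unfolding tensor2_def
  proof (intro conjI ballI allI impI)
    fix c x assume "c \<in> atlas X" "x \<in> coords c"
    then have "bilinear (\<phi> c x)" using t by (auto simp: tensor2_def)
    then show "bilinear (\<alpha> c x)"
      unfolding bilinear_def \<alpha> using linear_compose[OF _ lin, unfolded o_def] by blast
  next
    fix c u v assume "c \<in> atlas X"
    then show "smooth_on (coords c) (\<lambda>x. \<alpha> c x u v)"
      using t Ck_on_bounded_linear[OF bounded_linear_Re_double complex_manifoldD(3)[OF X]]
      unfolding \<alpha> smooth_on_def tensor2_def by blast
  next
    fix c d p assume "c \<in> atlas X" "d \<in> atlas X" "p \<in> fst c \<inter> fst d"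
    then show "let D = frechet_derivative (transition c d) (at (snd c p))
        in \<forall>u v. \<alpha> c (snd c p) u v = \<alpha> d (snd d p) (D u) (D v)"
      using t unfolding tensor2_def Let_def \<alpha> by metis
  next
    fix c x assume "c \<notin> atlas X \<or> x \<notin> coords c"
    then show "\<alpha> c x = (\<lambda>_ _. 0)" using H20_eq_0[OF \<phi>, of c x] by (simp add: \<alpha> fun_eq_iff)
  qed
  then show "two_form X \<alpha>" by (simp add: two_form_def \<alpha> alt)
qed

text \<open>The exterior derivative of \<open>h dz1 \<and> dz2\<close> is
  \<open>\<partial>h \<and> dz1 \<and> dz2\<close>, a (3,0)-form, and a surface carries no nonzero
  ones.\<close>

lemma calH_closed:
  assumes X: "complex_manifold I2 X" and \<alpha>: "\<alpha> \<in> calH X"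
  shows "\<alpha> \<in> closed_two_forms X"
proof -
  have "d2 \<alpha> c x u v w = 0" if c: "c \<in> atlas X" and x: "x \<in> coords c" for c x u v w
  proof -
    let ?h = "zero_divisor X \<alpha> c" and ?det = "\<lambda>u v :: complex \<times> complex. fst u * snd v - snd u * fst v"
    define h' where "h' = frechet_derivative ?h (at x)"
    have h: "(?h has_derivative h') (at x)" and I: "h' (I2 v) = \<i> * h' v" for v
      using zero_divisor_local(1)[OF X \<alpha> c] x by (auto simp: holo_on_def h'_def frechet_derivative_works I1_def simp del: split_paired_All)
    have der: "frechet_derivative (\<lambda>y. \<alpha> c y v w) (at x) u = 2 * Re (h' u * ?det v w)" for u v w
    proof -
      have "((\<lambda>y. 2 * Re (?h y * ?det v w)) has_derivative (\<lambda>u. 2 * Re (h' u * ?det v w))) (at x)"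
        by (intro bounded_linear.has_derivative[OF bounded_linear_Re_double] has_derivative_mult_left h)
      then have "((\<lambda>y. \<alpha> c y v w) has_derivative (\<lambda>u. 2 * Re (h' u * ?det v w))) (at x)"
        by (rule has_derivative_transform_within_open[OF _ complex_manifoldD(3)[OF X c] x])
          (simp add: zero_divisor_local(2)[OF X \<alpha> c])
      then show ?thesis by (simp flip: frechet_derivative_at)
    qed
    have lin: "linear h'" using h by (rule has_derivative_linear)
    have h'_eq: "h' u = fst u * h' (1, 0) + snd u * h' (0, 1)" for u
    proof -
      have "h' u = h' (Re (fst u) *\<^sub>R (1, 0) + Im (fst u) *\<^sub>R I2 (1, 0) + Re (snd u) *\<^sub>R (0, 1) + Im (snd u) *\<^sub>R I2 (0, 1))"
        by (rule arg_cong) (simp add: I2_def prod_eq_iff complex_eq_iff)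
      also have "\<dots> = Re (fst u) *\<^sub>R h' (1, 0) + Im (fst u) *\<^sub>R (\<i> * h' (1, 0)) +
          Re (snd u) *\<^sub>R h' (0, 1) + Im (snd u) *\<^sub>R (\<i> * h' (0, 1))"
        by (simp only: linear_add[OF lin] linear_scale[OF lin] I)
      finally show ?thesis by (simp add: complex_eq_iff algebra_simps)
    qed
    \<comment> \<open>The left side is a 3 by 3 determinant whose rows are \<open>h'\<close> and the
      two coordinates, applied to \<open>u\<close>, \<open>v\<close>, \<open>w\<close>. By
      \<open>h'_eq\<close> the first row is a combination of the other two.\<close>
    have "h' u * ?det v w - h' v * ?det u w + h' w * ?det u v = 0"
      by (simp add: h'_eq[of u] h'_eq[of v] h'_eq[of w] algebra_simps)
    then have "Re (h' u * ?det v w) - Re (h' v * ?det u w) + Re (h' w * ?det u v) = 0"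
      by (metis minus_complex.simps(1) plus_complex.simps(1) zero_complex.simps(1))
    then show ?thesis by (simp only: d2_def der)
  qed
  then show ?thesis using calH_tensor2[OF assms] by (simp add: closed_two_forms_def)
qed

text \<open>The product has type (3,1)+(1,3), hence vanishes on a surface. In real terms, \<eta> is
  invariant under \<open>I2\<close> while \<alpha> changes sign and is zero on complex lines, so the
  mixed terms cancel in pairs.\<close>

lemma wedge_type11_calH:
  assumes X: "complex_manifold I2 X" and \<eta>: "type11_form X \<eta>" and \<alpha>: "\<alpha> \<in> calH X"
  shows "wedge22 (\<eta> c x) (\<alpha> c x) (1, 0) (\<i>, 0) (0, 1) (0, \<i>) = 0"
proof (cases "c \<in> atlas X \<and> x \<in> coords c")
  case True
  obtain a :: "nat \<Rightarrow> nat \<Rightarrow> complex" where a: "\<And>u v. complex_of_real (\<eta> c x u v) = (\<Sum>j\<in>{1,2}. \<Sum>k\<in>{1,2}.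
      a j k * (zcoord j u * cnj (zcoord k v) - zcoord j v * cnj (zcoord k u)))"
    using \<eta> True unfolding type11_form_def by blast
  have "complex_of_real (\<eta> c x (I2 u) (I2 v)) = complex_of_real (\<eta> c x u v)" for u v
    unfolding a by (simp add: zcoord_def I2_def algebra_simps)
  then have J: "\<eta> c x (I2 u) (I2 v) = \<eta> c x u v" for u v
    by (metis of_real_eq_iff)
  have "complex_of_real (\<eta> c x u (- v)) = complex_of_real (- \<eta> c x u v)" for u v
    unfolding of_real_minus a by (simp add: zcoord_def algebra_simps)
  then have "\<eta> c x u (- v) = - \<eta> c x u v" for u v
    by (metis of_real_eq_iff)
  from this[of "(1, 0)" "(0, \<i>)"] have "\<eta> c x (\<i>, 0) (0, \<i>) = \<eta> c x (1, 0) (0, 1)" "\<eta> c x (\<i>, 0) (0, 1) = - \<eta> c x (1, 0) (0, \<i>)"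
    using J[of "(1, 0)" "(0, 1)"] J[of "(1, 0)" "- (0, \<i>)"] by (simp_all add: I2_def)
  then show ?thesis
    using True by (simp add: wedge22_def zero_divisor_local(2)[OF X \<alpha>] algebra_simps)
next
  case False
  then have "\<alpha> c x = (\<lambda>_ _. 0)"
    using calH_tensor2(1)[OF X \<alpha>] unfolding tensor2_def by blast
  then show ?thesis by (simp add: wedge22_def)
qed

text \<open>\<open>I_a\<close> holds because \<open>h dz1 \<and> dz2\<close> is complex bilinear;
  the defining property of \<open>K_endo\<close> comes from \<open>riesz_bilinear\<close>.\<close>

lemma hermitian_pair_kaehler:
  assumes X: "complex_manifold I2 X" and g: "kaehler_metric X g" and \<alpha>: "\<alpha> \<in> calH X"
    and d: "d \<in> atlas X" "y \<in> coords d"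
  shows "hermitian_pair (g d y) (\<alpha> d y) (K_endo g \<alpha> d y)"
proof
  show bil_g: "bilinear (g d y)" using g d by (auto simp: kaehler_metric_def tensor2_def)
  show pos: "g d y u u > 0" if "u \<noteq> 0" for u using g d that by (auto simp: kaehler_metric_def simp del: split_paired_All)
  show "g d y (I2 u) (I2 v) = g d y u v" for u v using g d by (auto simp: kaehler_metric_def simp del: split_paired_All)
  show bil_a: "bilinear (\<alpha> d y)" using calH_tensor2[OF X \<alpha>] d by (auto simp: tensor2_def)
  show "\<alpha> d y u u = 0" for u using calH_tensor2(2)[OF X \<alpha>] unfolding two_form_def by blast
  show "\<alpha> d y (I2 u) v = \<alpha> d y u (I2 v)" for u v
    by (simp add: zero_divisor_local(2)[OF X \<alpha> d] I2_def algebra_simps)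
  show "g d y u (K_endo g \<alpha> d y v) = \<alpha> d y u v" for u v
  proof -
    have "linear (\<lambda>u. \<alpha> d y u v)" using bil_a unfolding bilinear_def by blast
    from theI'[OF riesz_bilinear[OF bil_g pos this]] show ?thesis
      unfolding K_endo_def by blast
  qed
qed

section \<open>The energy argument\<close>

text \<open>\<open>F\<close> stands for \<open>f \<circ> \<nu>\<close>: on the normalization there
  are no nodes at which a differential would have to be taken.\<close>

locale J_alpha_curve =
  fixes X :: "('x, complex \<times> complex) manifold"
    and g \<alpha> :: "('x, complex \<times> complex, real) field2"
    and S :: "('s, complex) manifold"
    and F :: "'s \<Rightarrow> 'x"
  assumes X: "complex_manifold I2 X" and g: "kaehler_metric X g" and \<alpha>: "\<alpha> \<in> calH X"
    and S: "complex_manifold I1 S" and F: "pseudoholomorphic S X (J_alpha g \<alpha>) F"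
begin

abbreviation dF :: "('s, complex) chart \<Rightarrow> ('x, complex \<times> complex) chart \<Rightarrow> 's \<Rightarrow> complex \<Rightarrow> complex \<times> complex" where
  "dF c d s \<equiv> frechet_derivative (local_expr c d F) (at (snd c s))"

lemma smooth: "smooth_map S X F"
  using F by (simp add: pseudoholomorphic_def)

lemma mem_X: "c \<in> atlas S \<Longrightarrow> s \<in> fst c \<Longrightarrow> \<exists>d\<in>atlas X. F s \<in> fst d"
  using smooth X openin_subset[OF complex_manifoldD(2)[OF S, of c]]
  by (fastforce simp: smooth_map_def complex_manifold_def continuous_map_def)

context
  fixes c d s
  assumes c: "c \<in> atlas S" and d: "d \<in> atlas X" and s: "s \<in> fst c" "F s \<in> fst d"
begin

lemma pair: "hermitian_pair (g d (snd d (F s))) (\<alpha> d (snd d (F s))) (K_endo g \<alpha> d (snd d (F s)))"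
  by (rule hermitian_pair_kaehler[OF X g \<alpha> d coord_mem[OF s(2)]])

lemma linear_dF: "linear (dF c d s)"
  by (rule linear_frechet_derivative[OF local_expr_differentiable(1)[OF smooth c d s]])

lemma dF_J_alpha:
  "(1/2) *\<^sub>R (dF c d s v + (inv (hermitian_pair.B (K_endo g \<alpha> d (snd d (F s)))) \<circ> I2 \<circ>
      hermitian_pair.B (K_endo g \<alpha> d (snd d (F s)))) (dF c d s (I1 v))) = 0"
proof -
  have "hermitian_pair.B (K_endo g \<alpha> d (snd d (F s))) = (\<lambda>v. v + I2 (K_endo g \<alpha> d (snd d (F s)) v))"
    by (intro ext hermitian_pair.B_def[OF pair])
  then show ?thesis
    using F c d s unfolding pseudoholomorphic_def Let_def J_alpha_def by auto
qed

lemma pullback_eq: "pullback_coeff X F \<alpha> c (snd c s) =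
    \<alpha> d (snd d (F s)) (dF c d s 1) (dF c d s \<i>)"
  by (rule pullback_coeff_chart[OF S X smooth calH_tensor2(1)[OF X \<alpha>] c d s])

text \<open>By \<open>energy\<close> the coefficient is half a \<open>g\<close>-square. This sign is
  what lets a vanishing total integral force pointwise vanishing.\<close>

lemma pullback_nonneg: "pullback_coeff X F \<alpha> c (snd c s) \<ge> 0"
proof -
  have "g d (snd d (F s)) u u \<ge> 0" for u
    using hermitian_pair.pos_g[OF pair, of u] bilinear_lzero[OF hermitian_pair.bil_g[OF pair]]
    by (cases "u = 0") auto
  then show ?thesis
    unfolding pullback_eq hermitian_pair.energy[OF pair linear_dF dF_J_alpha] by simp
qed

lemma dbar_zero:
  assumes "pullback_coeff X F \<alpha> c (snd c s) = 0"
  shows "dF c d s v + I2 (dF c d s (I1 v)) = 0"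
    and "zero_divisor X \<alpha> d (snd d (F s)) \<noteq> 0 \<Longrightarrow> dF c d s v = 0"
proof -
  let ?y = "snd d (F s)"
  have 0: "\<alpha> d ?y (dF c d s 1) (dF c d s \<i>) = 0"
    using assms by (simp add: pullback_eq)
  show dbar: "dF c d s v + I2 (dF c d s (I1 v)) = 0" for v
    by (rule hermitian_pair.dbar_zero(1)[OF pair linear_dF dF_J_alpha 0])
  assume h: "zero_divisor X \<alpha> d ?y \<noteq> 0"
  have "\<alpha> d ?y u (dF c d s \<i>) = 0" for u
    using hermitian_pair.dbar_zero(2)[OF pair linear_dF dF_J_alpha 0]
      hermitian_pair.K[OF pair, of u "dF c d s \<i>"] bilinear_rzero[OF hermitian_pair.bil_g[OF pair]]
    by simp
  then have Re0: "Re (zero_divisor X \<alpha> d ?y * (fst u * snd w - snd u * fst w)) = 0" if "w = dF c d s \<i>" for u w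
    using that by (simp add: zero_divisor_local(2)[OF X \<alpha> d coord_mem[OF s(2)]])
  \<comment> \<open>The four real test vectors give the real and imaginary parts of the coefficient
    times each component of \<open>w\<close>: \<alpha> is nondegenerate off its zeros.\<close>
  have "zero_divisor X \<alpha> d ?y * z = 0" if "z = fst w \<or> z = snd w" "w = dF c d s \<i>" for z w
    using that(1) Re0[OF that(2), of "(1, 0)"] Re0[OF that(2), of "(\<i>, 0)"]
      Re0[OF that(2), of "(0, 1)"] Re0[OF that(2), of "(0, \<i>)"]
    by (auto simp: complex_eq_iff)
  then have Di: "dF c d s \<i> = 0" using h by (simp add: prod_eq_iff)
  have D1: "dF c d s 1 = 0" using dbar[of 1] Di linear_0[OF linear_I2] by (simp add: I1_def)
  show "dF c d s v = 0" using linear_complex[OF linear_dF, of v] Di D1 by simp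
qed

end

section \<open>Continuity of the pulled-back coefficient\<close>

lemma continuous_on_zero_divisor:
  assumes c: "c \<in> atlas S" and d: "d \<in> atlas X"
  shows "continuous_on (snd c ` (fst c \<inter> F -` fst d)) (\<lambda>x. zero_divisor X \<alpha> d (local_expr c d F x))"
proof (rule continuous_on_compose2[OF _ local_expr_differentiable(2)[OF smooth c d]])
  show "continuous_on (coords d) (zero_divisor X \<alpha> d)"
    using zero_divisor_local(1)[OF X \<alpha> d]
    by (auto simp: holo_on_def intro!: continuous_at_imp_continuous_on differentiable_imp_continuous_within)
  show "local_expr c d F ` (snd c ` (fst c \<inter> F -` fst d)) \<subseteq> coords d"
    by (auto simp: local_expr_coord[OF complex_manifoldD(1)[OF S c]] coord_mem)
qed

text \<open>The target chart chosen in \<open>pullback_coeff\<close> may jump with the point. Near a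
  given point it can be replaced by a fixed chart \<open>d\<close>, where the coefficient is an
  explicit expression in the local equation of the divisor and the first derivatives of
  \<open>F\<close>.\<close>

lemma pullback_continuous:
  assumes c: "c \<in> atlas S"
  shows "continuous_on (coords c) (pullback_coeff X F \<alpha> c)"
proof (rule continuous_at_imp_continuous_on, intro ballI)
  fix x assume "x \<in> coords c"
  then obtain s where s: "s \<in> fst c" "x = snd c s" by (auto simp: coords_def)
  obtain d where d: "d \<in> atlas X" "F s \<in> fst d" using mem_X[OF c s(1)] by blast
  note chc = complex_manifoldD(1)[OF S c] and chd = complex_manifoldD(1)[OF X d(1)]
  define W where "W = snd c ` (fst c \<inter> F -` fst d)"
  have W: "open W" "x \<in> W"
    unfolding W_def using smooth s d by (auto intro!: open_overlap[OF chc chd] simp: smooth_map_def)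
  let ?D = "\<lambda>x. frechet_derivative (local_expr c d F) (at x)" and ?h = "zero_divisor X \<alpha> d"
  have "continuous_on W (\<lambda>x. ?h (local_expr c d F x))"
    unfolding W_def by (rule continuous_on_zero_divisor[OF c d(1)])
  then have "continuous_on W (\<lambda>x. 2 * Re (?h (local_expr c d F x) *
      (fst (?D x 1) * snd (?D x \<i>) - snd (?D x 1) * fst (?D x \<i>))))"
    using local_expr_differentiable(3)[OF smooth c d(1)] unfolding W_def
    by (intro continuous_intros)
  moreover have "2 * Re (?h (local_expr c d F x) *
      (fst (?D x 1) * snd (?D x \<i>) - snd (?D x 1) * fst (?D x \<i>))) = pullback_coeff X F \<alpha> c x" if "x \<in> W" for x
    using that
    by (auto simp: W_def local_expr_coord[OF chc] pullback_eq[OF c d(1)]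
      zero_divisor_local(2)[OF X \<alpha> d(1) coord_mem])
  ultimately have "continuous_on W (pullback_coeff X F \<alpha> c)"
    by (simp cong: continuous_on_cong)
  then show "isCont (pullback_coeff X F \<alpha> c) x"
    using W continuous_on_eq_continuous_at by blast
qed

section \<open>Consequences of the vanishing of the integral of the pullback of \<alpha>\<close>

context
  assumes compact: "compact_space (space_of S)" and int0: "curve_integral S X F \<alpha> = 0"
begin

text \<open>The vanishing is known in some chart \<open>b\<close> around \<open>s\<close>. The chain
  rule transports it to \<open>c\<close>, and holomorphy of the transition map lets
  \<open>I1\<close> pass through.\<close>

lemma dF_dbar_zero:
  assumes c: "c \<in> atlas S" and d: "d \<in> atlas X" and s: "s \<in> fst c" "F s \<in> fst d"
  shows "dF c d s v + I2 (dF c d s (I1 v)) = 0"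
    and "zero_divisor X \<alpha> d (snd d (F s)) \<noteq> 0 \<Longrightarrow> dF c d s v = 0"
proof -
  have "s \<in> topspace (space_of S)"
    using openin_subset[OF complex_manifoldD(2)[OF S c]] s by blast
  moreover have "pullback_coeff X F \<alpha> b x \<ge> 0" if "b \<in> atlas S" "x \<in> coords b" for b x
    using that mem_X[OF that(1)] pullback_nonneg[OF that(1)] unfolding coords_def by blast
  ultimately obtain b where b: "b \<in> atlas S" "s \<in> fst b" "pullback_coeff X F \<alpha> b (snd b s) = 0"
    using manifold_integral_eq_0D[OF S compact pullback_continuous] int0
    unfolding curve_integral_def by blast
  note tr = local_expr_change_source[OF S X smooth b(1) c d b(2) s]
  note I = transition_differentiable(2)[OF S c b(1) s(1) b(2)]
  show "dF c d s v + I2 (dF c d s (I1 v)) = 0"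
    unfolding tr I by (rule dbar_zero(1)[OF b(1) d b(2) s(2) b(3)])
  show "dF c d s v = 0" if "zero_divisor X \<alpha> d (snd d (F s)) \<noteq> 0"
    unfolding tr by (rule dbar_zero(2)[OF b(1) d b(2) s(2) b(3) that])
qed

lemma holomorphic: "pseudoholomorphic S X J_std F"
  unfolding pseudoholomorphic_def Let_def J_std_def
  using smooth dF_dbar_zero(1) by simp

text \<open>Off the zero divisor the differential of \<open>F\<close> vanishes, and being off it is
  an open condition, so the local expression is constant near the point. Injectivity of the target
  chart then gives constancy of \<open>F\<close>.\<close>

lemma locally_constant:
  assumes s: "s \<in> topspace (space_of S)" and ns: "F s \<notin> divisor_support X (zero_divisor X \<alpha>)"
  shows "\<exists>U. openin (space_of S) U \<and> s \<in> U \<and> (\<forall>s'\<in>U. F s' = F s)"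
proof -
  obtain c where c: "c \<in> atlas S" "s \<in> fst c" using S s by (auto simp: complex_manifold_def)
  have "F s \<in> topspace (space_of X)" using smooth s by (auto simp: smooth_map_def continuous_map_def)
  then obtain d where d: "d \<in> atlas X" "F s \<in> fst d" and h: "zero_divisor X \<alpha> d (snd d (F s)) \<noteq> 0"
    using ns by (auto simp: divisor_support_def)
  note chc = complex_manifoldD(1)[OF S c(1)] and chd = complex_manifoldD(1)[OF X d(1)]
  define W where "W = snd c ` (fst c \<inter> F -` fst d)"
  define W' where "W' = W \<inter> (\<lambda>x. zero_divisor X \<alpha> d (local_expr c d F x)) -` (- {0})"
  have W: "open W"
    unfolding W_def using smooth by (auto intro!: open_overlap[OF chc chd] simp: smooth_map_def)
  have "continuous_on W (\<lambda>x. zero_divisor X \<alpha> d (local_expr c d F x))"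
    unfolding W_def by (rule continuous_on_zero_divisor[OF c(1) d(1)])
  then have "open W'" unfolding W'_def using W by (intro continuous_open_preimage) auto
  moreover have "snd c s \<in> W'"
    using c d h by (auto simp: W'_def W_def local_expr_coord[OF chc])
  \<comment> \<open>A ball is taken for its convexity, which allows passing from zero derivative to
    constancy.\<close>
  ultimately obtain e where e: "e > 0" "ball (snd c s) e \<subseteq> W'" by (meson openE)
  have der0: "(local_expr c d F has_derivative (\<lambda>_. 0)) (at x)" if x: "x \<in> W'" for x
  proof -
    obtain p where p: "p \<in> fst c" "F p \<in> fst d" "x = snd c p" using x by (auto simp: W'_def W_def)
    then have "zero_divisor X \<alpha> d (snd d (F p)) \<noteq> 0"
      using x by (auto simp: W'_def local_expr_coord[OF chc])
    then have "dF c d p = (\<lambda>_. 0)" using dF_dbar_zero(2)[OF c(1) d(1) p(1,2)] by blast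
    then show ?thesis
      using local_expr_differentiable(1)[OF smooth c(1) d(1) p(1,2)] p(3)
      by (metis frechet_derivative_works)
  qed
  have const: "local_expr c d F x = local_expr c d F (snd c s)" if "x \<in> ball (snd c s) e" for x
  proof (rule has_derivative_zero_unique[of "ball (snd c s) e"])
    show "(local_expr c d F has_derivative (\<lambda>h. 0)) (at y within ball (snd c s) e)"
      if "y \<in> ball (snd c s) e" for y
      by (rule has_derivative_at_withinI[OF der0[OF subsetD[OF e(2) that]]])
  qed (use that e in auto)
  have sub: "ball (snd c s) e \<subseteq> coords c" using e by (auto simp: W'_def W_def coords_def)
  define U where "U = point_of c ` ball (snd c s) e"
  have "openin (space_of S) U"
    unfolding U_def using sub by (intro openin_point_of_image[OF chc]) auto
  moreover have "s \<in> U"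
    unfolding U_def using e c by (intro image_eqI[of _ _ "snd c s"]) (auto simp: point_of_coord[OF chc])
  moreover have "F s' = F s" if s': "s' \<in> U" for s'
  proof -
    obtain x where x: "x \<in> ball (snd c s) e" "s' = point_of c x" using s' by (auto simp: U_def)
    then obtain p where p: "p \<in> fst c" "F p \<in> fst d" "x = snd c p"
      using e by (auto simp: W'_def W_def)
    have "snd d (F p) = snd d (F s)"
      using const[OF x(1)] p c by (simp add: local_expr_coord[OF chc])
    then have "F p = F s" using p d by (metis point_of_coord[OF chd])
    then show ?thesis using x p by (simp add: point_of_coord[OF chc])
  qed
  ultimately show ?thesis by blast
qed

end
end

section \<open>Integrals over constant maps\<close>

lemma curve_integral_constant:
  assumes S: "complex_manifold i S" and comp: "compact_space (space_of S)" and X: "complex_manifold i' X"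
    and \<omega>: "tensor2 X \<omega>" and F: "smooth_map S X F" and const: "\<And>s. s \<in> topspace (space_of S) \<Longrightarrow> F s = p"
  shows "curve_integral S X F \<omega> = 0"
  unfolding curve_integral_def
proof (rule manifold_integral_0[OF S comp])
  fix c x assume c: "c \<in> atlas S" "x \<in> coords c"
  note chc = complex_manifoldD(1)[OF S c(1)] complex_manifoldD(3)[OF S c(1)]
  have top: "q \<in> topspace (space_of S)" if "q \<in> fst c" for q
    using openin_subset[OF complex_manifoldD(2)[OF S c(1)]] that by blast
  obtain s where s: "s \<in> fst c" "x = snd c s" using c by (auto simp: coords_def)
  have "F s \<in> topspace (space_of X)"
    using F top[OF s(1)] by (auto simp: smooth_map_def continuous_map_def)
  then obtain d where d: "d \<in> atlas X" "F s \<in> fst d" using X by (auto simp: complex_manifold_def)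
  \<comment> \<open>\<open>F\<close> is known to be constant only on the space of \<open>S\<close>,
    hence its local expression only on the range of the chart; this range is open and so determines
    the derivative.\<close>
  have eq: "snd d p = local_expr c d F y" if "y \<in> coords c" for y
    using const[OF top[OF point_of_mem[OF that]]] by (simp add: local_expr_def)
  have "frechet_derivative (local_expr c d F) (at x) = frechet_derivative (\<lambda>_. snd d p) (at x)"
    by (rule frechet_derivative_cong_open(2)[OF chc(2) c(2) eq]) auto
  moreover have "bilinear (\<omega> d (snd d (F s)))"
    using \<omega> d coord_mem[OF d(2)] by (auto simp: tensor2_def)
  ultimately show "pullback_coeff X F \<omega> c x = 0"
    using pullback_coeff_chart[OF S X F \<omega> c(1) d(1) s(1) d(2)] s
    by (simp add: bilinear_lzero)
qed

theorem lemma3p2: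
  fixes X :: "('x, complex \<times> complex) manifold"
    and g \<alpha> :: "('x, complex \<times> complex, real) field2"
    and S :: "('s, complex) manifold"
    and C :: "'c topology"
    and \<nu> :: "'s \<Rightarrow> 'c"
    and f :: "'c \<Rightarrow> 'x"
    and A :: "('x, complex \<times> complex, real) field2 \<Rightarrow> real"
  assumes "compact_kaehler_surface X g"
    and "geometric_genus X > 0"
    and "\<alpha> \<in> calH X"
    and "\<alpha> \<noteq> 0"
    and "connected_nodal_curve S C \<nu>"
    and "pseudoholomorphic S X (J_alpha g \<alpha>) (f \<circ> \<nu>)"
    and "A \<in> H2 X"
    and "A \<noteq> 0"
    and "type11_class X A"
    and "represents S X (f \<circ> \<nu>) A"
  shows "pseudoholomorphic S X J_std (f \<circ> \<nu>) \<and>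
         f ` topspace C \<subseteq> divisor_support X (zero_divisor X \<alpha>)"
proof -
  have X: "complex_manifold I2 X" "kaehler_metric X g" and Xc: "compact_space (space_of X)"
    using assms(1) by (auto simp: compact_kaehler_surface_def)
  have S: "complex_manifold I1 S" "compact_space (space_of S)"
    and q: "quotient_map (space_of S) C \<nu>" and C: "connected_space C"
    using assms(5) by (auto simp: connected_nodal_curve_def)
  interpret curve: J_alpha_curve X g \<alpha> S "f \<circ> \<nu>"
    by unfold_locales (fact X S assms(3,6))+
  obtain \<eta> where \<eta>: "type11_form X \<eta>"
    and A: "\<And>\<omega>. \<omega> \<in> closed_two_forms X \<Longrightarrow> A \<omega> = surface_wedge_integral X \<eta> \<omega>"
    using assms(9) by (auto simp: type11_class_def)
  have closed: "\<alpha> \<in> closed_two_forms X" by (rule calH_closed[OF X(1) assms(3)])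
  \<comment> \<open>The pairing of \<open>A\<close> with \<alpha> is computed twice: on the curve,
    which represents \<open>A\<close>, and on \<open>X\<close>, through the (1,1) representative
    \<eta> of the Poincare dual.\<close>
  have "curve_integral S X (f \<circ> \<nu>) \<alpha> = surface_wedge_integral X \<eta> \<alpha>"
    using assms(10) A closed by (simp add: represents_def)
  also have "\<dots> = 0"
    unfolding surface_wedge_integral_def
    by (rule manifold_integral_0[OF X(1) Xc wedge_type11_calH[OF X(1) \<eta> assms(3)]])
  finally have int0: "curve_integral S X (f \<circ> \<nu>) \<alpha> = 0" .
  have img: "\<nu> ` topspace (space_of S) = topspace C"
    using q by (simp add: quotient_imp_surjective_map)
  \<comment> \<open>Continuity descends along the quotient map. The open-and-closed argument has to
    run on \<open>C\<close>, because \<open>S\<close> may be disconnected.\<close>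
  have fcont: "continuous_map C (space_of X) f"
    using continuous_compose_quotient_map[OF q] curve.smooth by (auto simp: smooth_map_def)
  have "f p \<in> divisor_support X (zero_divisor X \<alpha>)" if p: "p \<in> topspace C" for p
  proof (rule ccontr)
    assume np: "f p \<notin> divisor_support X (zero_divisor X \<alpha>)"
    define P where "P = {r \<in> topspace C. f r = f p}"
    have "f p \<in> topspace (space_of X)" using fcont p by (auto simp: continuous_map_def)
    then have "closedin (space_of X) {f p}"
      using X(1) by (simp add: complex_manifold_def closedin_Hausdorff_singleton)
    then have "closedin C P"
      using closedin_continuous_map_preimage[OF fcont] by (fastforce simp: P_def)
    moreover have "openin C P"
    proof -
      \<comment> \<open>Openness in a quotient is tested on the preimage in \<open>S\<close>. There
        \<open>f \<circ> \<nu>\<close> takes the value \<open>f p\<close>, which lies off the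
        support, so \<open>locally_constant\<close> applies at each point.\<close>
      have "openin (space_of S) {s \<in> topspace (space_of S). \<nu> s \<in> P}"
      proof (subst openin_subopen, clarify)
        fix s assume s: "s \<in> topspace (space_of S)" "\<nu> s \<in> P"
        then obtain U where U: "openin (space_of S) U" "s \<in> U" "\<forall>s'\<in>U. (f \<circ> \<nu>) s' = (f \<circ> \<nu>) s"
          using curve.locally_constant[OF S(2) int0, of s] np by (auto simp: P_def)
        have "\<nu> s' \<in> P" if "s' \<in> U" for s'
        proof -
          have "f (\<nu> s') = f (\<nu> s)" using U(3) that by simp
          moreover have "\<nu> s' \<in> topspace C" using img openin_subset[OF U(1)] that by blast
          ultimately show ?thesis using s by (simp add: P_def)
        qed
        then show "\<exists>U. openin (space_of S) U \<and> s \<in> U \<and> U \<subseteq> {s \<in> topspace (space_of S). \<nu> s \<in> P}"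
          using U(1,2) openin_subset[OF U(1)] by blast
      qed
      moreover have "P \<subseteq> topspace C" by (auto simp: P_def)
      ultimately show ?thesis using q unfolding quotient_map_def by blast
    qed
    ultimately have "P = topspace C"
      using C p unfolding connected_space_clopen_in by (auto simp: P_def)
    then have const: "(f \<circ> \<nu>) s = f p" if "s \<in> topspace (space_of S)" for s
      using that img by (auto simp: P_def)
    \<comment> \<open>On closed forms the value is an integral over a constant map; on all other
      fields \<open>H2\<close> sets it to 0, so \<open>A\<close> is zero as a function.\<close>
    have "A \<omega> = 0" for \<omega>
    proof (cases "\<omega> \<in> closed_two_forms X")
      case True
      then have "tensor2 X \<omega>" by (auto simp: closed_two_forms_def two_form_def)
      then have "curve_integral S X (f \<circ> \<nu>) \<omega> = 0"
        using curve_integral_constant[OF S X(1) _ curve.smooth const] by blast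
      then show ?thesis using assms(10) True by (simp add: represents_def)
    next
      case False
      then show ?thesis using assms(7) by (simp add: H2_def)
    qed
    then show False using assms(8) by (simp add: fun_eq_iff)
  qed
  then show ?thesis using curve.holomorphic[OF S(2) int0] by blast
qed

end
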